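(* Let $\Gamma$ be a finite simple graph whose edges are labeled by integers $\ge 2$, and let $A_\Gamma$ be the associated Artin group. Suppose that $A_\Gamma$ is irreducible and that $\Gamma$ is not a clique. Let $\Gamma_0$ be the maximal clique factor of $\Gamma$. Then the center $Z(A_\Gamma)$ is finite. Moreover, $Z(A_\Gamma)$ is contained in $Z(A_{\Gamma_0})$. In particular, if $Z(A_{\Gamma_0})$ is trivial or torsion-free, then $Z(A_\Gamma)$ is trivial.
   Context: Let $\Gamma$ be a finite simple graph with vertex set $V(\Gamma)$ and edge set $E(\Gamma)$, each edge $e$ with endpoints $s_e,t_e$ being labeled by an integer $\mu(e)\ge 2$. The Artin group associated with $\Gamma$ is $$A_\Gamma=\langle V(\Gamma)\mid \underbrace{s_et_es_et_e\cdots}_{\text{length }\mu(e)}=\underbrace{t_es_et_es_e\cdots}_{\text{length }\mu(e)}\ (e\in E(\Gamma))\rangle .$$ The Coxeter graph $\Gamma^t$ is the simple graph with vertex set $V(\Gamma)$ in which two distinct vertices are joined by an edge if and only if either they are not adjacent in $\Gamma$, or they are joined in $\Gamma$ by an edge with label $\ge 3$. $A_\Gamma$ is irreducible if $\Gamma^t$ is connected. $\Gamma$ is a clique if any two distinct vertices of $\Gamma$ are adjacent. The join of simple graphs is obtained from their disjoint union by adding an edge between any two vertices belonging to different graphs. Every finite simple graph $\Gamma$ has a unique decomposition as a join of indecomposable factors (factors that are not joins of two or more nonempty graphs). The maximal clique factor $\Gamma_0$ of $\Gamma$ is the join of all the indecomposable factors consisting of a single vertex ($\Gamma_0=\emptyset$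 if there are none). $A_{\Gamma_0}$ denotes the subgroup of $A_\Gamma$ generated by $V(\Gamma_0)$ (trivial if $\Gamma_0=\emptyset$), which is naturally the Artin group associated with the labeled graph $\Gamma_0$. $Z(G)$ denotes the center of a group $G$. *)

theory Defs
  imports "HOL-Algebra.Algebra"
begin

section \<open>Finite simple graphs\<close>

record 'v sgraph =
  verts :: "'v set"
  edges :: "'v set set"

definition finite_simple_graph :: "'v sgraph \<Rightarrow> bool" where
  "finite_simple_graph \<Gamma> \<longleftrightarrow>
     finite (verts \<Gamma>) \<and> (\<forall>e\<in>edges \<Gamma>. e \<subseteq> verts \<Gamma> \<and> card e = 2)"

definition is_clique :: "'v sgraph \<Rightarrow> bool" where
  "is_clique \<Gamma> \<longleftrightarrow>
     (\<forall>s\<in>verts \<Gamma>. \<forall>t\<in>verts \<Gamma>. s \<noteq> t \<longrightarrow> {s, t} \<in> edges \<Gamma>)"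

definition graph_connected :: "'v sgraph \<Rightarrow> bool" where
  "graph_connected \<Gamma> \<longleftrightarrow>
     (\<forall>s\<in>verts \<Gamma>. \<forall>t\<in>verts \<Gamma>. (s, t) \<in> {(u, v). {u, v} \<in> edges \<Gamma>}\<^sup>*)"

text \<open>
  The join of a set of graphs. It is the join in the usual sense only when the graphs have pairwise
  disjoint vertex sets, so that the union of the graphs is a disjoint union; this is imposed in
  \<open>is_join\<close>, which moreover only admits nonempty graphs. The empty graph is the join of the
  empty family.
\<close>

definition graph_join :: "'v sgraph set \<Rightarrow> 'v sgraph" where
  "graph_join F =
     \<lparr>verts = (\<Union>G\<in>F. verts G),
      edges = (\<Union>G\<in>F. edges G) \<union>
        {{x, y} | x y. \<exists>G\<in>F. \<exists>H\<in>F. G \<noteq> H \<and> x \<in> verts G \<and> y \<in> verts H}\<rparr>"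

definition is_join :: "'v sgraph \<Rightarrow> 'v sgraph set \<Rightarrow> bool" where
  "is_join \<Gamma> F \<longleftrightarrow>
     (\<forall>G\<in>F. finite_simple_graph G \<and> verts G \<noteq> {}) \<and>
     (\<forall>G\<in>F. \<forall>H\<in>F. G \<noteq> H \<longrightarrow> verts G \<inter> verts H = {}) \<and>
     \<Gamma> = graph_join F"

definition indecomposable :: "'v sgraph \<Rightarrow> bool" where
  "indecomposable \<Gamma> \<longleftrightarrow> verts \<Gamma> \<noteq> {} \<and> \<not> (\<exists>F. is_join \<Gamma> F \<and> 2 \<le> card F)"

definition join_decomposition :: "'v sgraph \<Rightarrow> 'v sgraph set \<Rightarrow> bool" where
  "join_decomposition \<Gamma> F \<longleftrightarrow> is_join \<Gamma> F \<and> (\<forall>G\<in>F. indecomposable G)"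

text \<open>Well defined for finite simple graphs, see \<open>join_decomposition_ex1\<close>.\<close>

definition join_factors :: "'v sgraph \<Rightarrow> 'v sgraph set" where
  "join_factors \<Gamma> = (THE F. join_decomposition \<Gamma> F)"

definition maximal_clique_factor :: "'v sgraph \<Rightarrow> 'v sgraph" where
  "maximal_clique_factor \<Gamma> = graph_join {G \<in> join_factors \<Gamma>. card (verts G) = 1}"

lemma finite_family_of_join:
  assumes "finite_simple_graph \<Gamma>" "is_join \<Gamma> F"
  shows "finite F"
proof -
  have "inj_on verts F"
    using assms(2) unfolding is_join_def inj_on_def by fastforce
  moreover have "verts ` F \<subseteq> Pow (verts \<Gamma>)"
    using assms(2) by (auto simp: is_join_def graph_join_def)
  moreover have "finite (Pow (verts \<Gamma>))"
    using assms(1) by (simp add: finite_simple_graph_def)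
  ultimately show ?thesis
    by (meson finite_imageD finite_subset)
qed

lemma join_factors_eqI:
  assumes "is_join \<Gamma> F" "G \<in> F" "H \<in> F" "verts G \<inter> verts H \<noteq> {}"
  shows "G = H"
  using assms unfolding is_join_def by blast

lemma join_factor_edges:
  assumes J: "is_join \<Gamma> F" and G: "G \<in> F"
  shows "edges G = {e \<in> edges \<Gamma>. e \<subseteq> verts G}"
proof
  show "edges G \<subseteq> {e \<in> edges \<Gamma>. e \<subseteq> verts G}"
    using J G by (auto simp: is_join_def graph_join_def finite_simple_graph_def)
  show "{e \<in> edges \<Gamma>. e \<subseteq> verts G} \<subseteq> edges G"
  proof clarify
    fix e assume e: "e \<in> edges \<Gamma>" "e \<subseteq> verts G"
    then consider H where "H \<in> F" "e \<in> edges H"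
      | x y H K where "e = {x, y}" "H \<in> F" "K \<in> F" "H \<noteq> K" "x \<in> verts H" "y \<in> verts K"
      using J by (auto simp: is_join_def graph_join_def)
    then show "e \<in> edges G"
    proof cases
      case 1
      then have "e \<subseteq> verts H" "card e = 2"
        using J by (auto simp: is_join_def finite_simple_graph_def)
      then have "e \<subseteq> verts H" "e \<noteq> {}" by auto
      with e have "verts G \<inter> verts H \<noteq> {}" by blast
      then have "H = G" using join_factors_eqI[OF J G] 1 by blast
      with 1 show ?thesis by simp
    next
      case 2
      then have "verts G \<inter> verts H \<noteq> {}" "verts G \<inter> verts K \<noteq> {}" using e by auto
      then have "H = G" "K = G" using join_factors_eqI[OF J G] 2 by blast+
      with 2 show ?thesis by simp
    qed
  qed
qed

lemma join_decomposition_exists: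
  assumes "finite_simple_graph \<Gamma>"
  shows "\<exists>F. join_decomposition \<Gamma> F"
  using assms
proof (induction "card (verts \<Gamma>)" arbitrary: \<Gamma> rule: less_induct)
  case less
  show ?case
  proof (cases "verts \<Gamma> = {}")
    case True
    then have "edges \<Gamma> = {}"
      using less.prems by (fastforce simp: finite_simple_graph_def)
    with True have "join_decomposition \<Gamma> {}"
      by (simp add: join_decomposition_def is_join_def graph_join_def)
    then show ?thesis ..
  next
    case ne: False
    show ?thesis
    proof (cases "indecomposable \<Gamma>")
      case True
      then have "join_decomposition \<Gamma> {\<Gamma>}"
        using less.prems ne by (simp add: join_decomposition_def is_join_def graph_join_def)
      then show ?thesis ..
    next
      case False
      then obtain F where J: "is_join \<Gamma> F" and c: "2 \<le> card F"
        using ne by (auto simp: indecomposable_def)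
      have "\<exists>D. join_decomposition G D" if G: "G \<in> F" for G
      proof (rule less.hyps)
        show "finite_simple_graph G" using J G by (simp add: is_join_def)
        have "\<exists>H\<in>F. H \<noteq> G"
        proof (rule ccontr)
          assume "\<not> (\<exists>H\<in>F. H \<noteq> G)"
          then have "F \<subseteq> {G}" by auto
          then have "card F \<le> 1" using card_mono[of "{G}" F] by simp
          with c show False by simp
        qed
        then obtain H where H: "H \<in> F" "H \<noteq> G" by blast
        then have "verts G \<inter> verts H = {}" "verts H \<noteq> {}" "verts H \<subseteq> verts \<Gamma>" "verts G \<subseteq> verts \<Gamma>"
          using J G by (auto simp: is_join_def graph_join_def)
        then have "verts G \<subset> verts \<Gamma>" by auto
        then show "card (verts G) < card (verts \<Gamma>)"
          using less.prems by (simp add: finite_simple_graph_def psubset_card_mono)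
      qed
      then obtain D where D: "\<And>G. G \<in> F \<Longrightarrow> join_decomposition G (D G)" by metis
      have DG: "G = graph_join (D G)" if "G \<in> F" for G
        using D[OF that] by (simp add: join_decomposition_def is_join_def)
      have v: "verts G = (\<Union>K\<in>D G. verts K)" if "G \<in> F" for G
        by (subst DG[OF that]) (simp add: graph_join_def)
      have e: "edges G = (\<Union>K\<in>D G. edges K) \<union>
          {{x, y} | x y. \<exists>K\<in>D G. \<exists>L\<in>D G. K \<noteq> L \<and> x \<in> verts K \<and> y \<in> verts L}" if "G \<in> F" for G
        by (subst DG[OF that]) (simp add: graph_join_def)
      have gr: "finite_simple_graph K" "verts K \<noteq> {}" "indecomposable K" if "G \<in> F" "K \<in> D G" for G K
        using D[OF that(1)] that(2) by (auto simp: join_decomposition_def is_join_def)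
      have sub: "verts K \<subseteq> verts G" if "G \<in> F" "K \<in> D G" for G K
        using v that by blast
      have disj: "verts G \<inter> verts H = {}" if "G \<in> F" "H \<in> F" "G \<noteq> H" for G H
        using J that by (simp add: is_join_def)
      have ddisj: "verts K \<inter> verts L = {}" if "G \<in> F" "H \<in> F" "K \<in> D G" "L \<in> D H" "K \<noteq> L" for G H K L
      proof (cases "G = H")
        case True
        then show ?thesis using D[OF that(1)] that by (simp add: join_decomposition_def is_join_def)
      next
        case False
        then show ?thesis using disj[OF that(1,2)] sub that by blast
      qed
      have ne': "K \<noteq> L" if "G \<in> F" "H \<in> F" "G \<noteq> H" "K \<in> D G" "L \<in> D H" for G H K L
        using disj[OF that(1-3)] sub[OF that(1,4)] sub[OF that(2,5)] gr(2)[OF that(1,4)] by blast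
      let ?U = "\<Union>G\<in>F. D G"
      have "verts (graph_join F) = verts (graph_join ?U)"
        using v by (auto simp: graph_join_def)
      moreover have "edges (graph_join F) = edges (graph_join ?U)"
      proof
        show "edges (graph_join F) \<subseteq> edges (graph_join ?U)"
        proof
          fix a assume "a \<in> edges (graph_join F)"
          then consider G where "G \<in> F" "a \<in> edges G"
            | x y G H where "a = {x, y}" "G \<in> F" "H \<in> F" "G \<noteq> H" "x \<in> verts G" "y \<in> verts H"
            by (auto simp: graph_join_def)
          then show "a \<in> edges (graph_join ?U)"
          proof cases
            case 1
            then show ?thesis using e[OF 1(1)] by (simp add: graph_join_def) blast
          next
            case 2
            then obtain K L where "K \<in> D G" "L \<in> D H" "x \<in> verts K" "y \<in> verts L"
              using v by blast
            moreover from this have "K \<noteq> L" using ne' 2 by blast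
            ultimately show ?thesis using 2 by (simp add: graph_join_def) blast
          qed
        qed
        show "edges (graph_join ?U) \<subseteq> edges (graph_join F)"
        proof
          fix a assume "a \<in> edges (graph_join ?U)"
          then consider G K where "G \<in> F" "K \<in> D G" "a \<in> edges K"
            | x y G H K L where "a = {x, y}" "G \<in> F" "H \<in> F" "K \<in> D G" "L \<in> D H" "K \<noteq> L"
                "x \<in> verts K" "y \<in> verts L"
            by (auto simp: graph_join_def)
          then show "a \<in> edges (graph_join F)"
          proof cases
            case 1
            then show ?thesis using e[OF 1(1)] by (auto simp: graph_join_def)
          next
            case 2
            show ?thesis
            proof (cases "G = H")
              case True
              then have "a \<in> edges G" using e[OF 2(2)] 2 by blast
              then show ?thesis using 2 by (auto simp: graph_join_def)
            next
              case False
              have "x \<in> verts G" "y \<in> verts H" using sub 2 by blast+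
              then show ?thesis using False 2 by (simp add: graph_join_def) blast
            qed
          qed
        qed
      qed
      ultimately have "\<Gamma> = graph_join ?U"
        using J by (simp add: is_join_def)
      then have "join_decomposition \<Gamma> ?U"
        using gr ddisj by (auto simp: join_decomposition_def is_join_def)
      then show ?thesis ..
    qed
  qed
qed

lemma indecomposable_factor_subset:
  fixes \<Gamma> :: "'v sgraph"
  assumes fin: "finite_simple_graph \<Gamma>" and J: "is_join \<Gamma> F" and J': "is_join \<Gamma> F'"
    and G: "G \<in> F" "indecomposable G"
  shows "\<exists>H\<in>F'. verts G \<subseteq> verts H"
proof -
  define I :: "'v sgraph \<Rightarrow> 'v sgraph" where "I H = \<lparr>verts = verts G \<inter> verts H, edges = {e \<in> edges G. e \<subseteq> verts H}\<rparr>" for H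
  define K where "K = {H \<in> F'. verts G \<inter> verts H \<noteq> {}}"
  have fsG: "finite_simple_graph G" using J G by (simp add: is_join_def)
  have cov: "verts G \<subseteq> (\<Union>H\<in>F'. verts H)"
    using J J' G by (auto simp: is_join_def graph_join_def)
  have disj: "verts H \<inter> verts L = {}" if "H \<in> K" "L \<in> K" "H \<noteq> L" for H L
    using J' that by (simp add: is_join_def K_def)
  have vI: "verts (I H) = verts G \<inter> verts H" for H by (simp add: I_def)
  have eI: "edges (I H) = {e \<in> edges G. e \<subseteq> verts H}" for H by (simp add: I_def)
  have inj: "inj_on I K"
  proof (rule inj_onI, rule ccontr)
    fix H L assume a: "H \<in> K" "L \<in> K" "I H = I L" "H \<noteq> L"
    then have "verts (I H) = verts (I L)" by simp
    then show False using disj[OF a(1,2,4)] a(1) unfolding vI K_def by blast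
  qed
  have "verts G = verts (graph_join (I ` K))"
    using cov by (auto simp: graph_join_def vI K_def)
  moreover have "edges G = edges (graph_join (I ` K))"
  proof
    show "edges G \<subseteq> edges (graph_join (I ` K))"
    proof
      fix e assume e: "e \<in> edges G"
      then have "card e = 2" "e \<subseteq> verts G" using fsG by (auto simp: finite_simple_graph_def)
      then obtain x y where xy: "e = {x, y}" "x \<in> verts G" "y \<in> verts G"
        by (auto simp: card_2_iff)
      then obtain H L where HL: "H \<in> K" "L \<in> K" "x \<in> verts H" "y \<in> verts L"
        using cov unfolding K_def by blast
      show "e \<in> edges (graph_join (I ` K))"
      proof (cases "H = L")
        case True
        then have "e \<in> edges (I H)" using e xy HL by (simp add: eI)
        then show ?thesis using HL by (auto simp: graph_join_def)
      next
        case False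
        then have "I H \<noteq> I L" using inj HL by (auto dest: inj_onD)
        moreover have "x \<in> verts (I H)" "y \<in> verts (I L)" using xy HL by (auto simp: vI)
        ultimately show ?thesis using xy HL by (simp add: graph_join_def) blast
      qed
    qed
    show "edges (graph_join (I ` K)) \<subseteq> edges G"
    proof
      fix e assume "e \<in> edges (graph_join (I ` K))"
      then consider H where "e \<in> edges (I H)"
        | x y H L where "e = {x, y}" "H \<in> K" "L \<in> K" "H \<noteq> L" "x \<in> verts (I H)" "y \<in> verts (I L)"
        by (simp add: graph_join_def) blast
      then show "e \<in> edges G"
      proof cases
        case 1
        then show ?thesis by (simp add: eI)
      next
        case 2
        then have "e \<in> edges (graph_join F')"
          by (simp add: graph_join_def vI K_def) blast
        then have "e \<in> edges \<Gamma>" using J' by (simp add: is_join_def)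
        moreover have "e \<subseteq> verts G" using 2 by (simp add: vI)
        ultimately show ?thesis using join_factor_edges[OF J G(1)] by simp
      qed
    qed
  qed
  ultimately have "G = graph_join (I ` K)" by simp
  moreover have "finite_simple_graph (I H)" for H
    using fsG by (auto simp: finite_simple_graph_def vI eI)
  ultimately have "is_join G (I ` K)"
    using disj by (auto simp: is_join_def vI K_def)
  then have "\<not> 2 \<le> card (I ` K)" using G(2) by (auto simp: indecomposable_def)
  then have c: "card K \<le> 1" using card_image[OF inj] by simp
  have "finite K" using finite_family_of_join[OF fin J'] by (simp add: K_def)
  obtain x where x: "x \<in> verts G" using G(2) by (auto simp: indecomposable_def)
  then obtain H where H: "H \<in> K" using cov by (auto simp: K_def)
  have "verts G \<subseteq> verts H"
  proof
    fix y assume y: "y \<in> verts G"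
    then obtain L where L: "L \<in> K" "y \<in> verts L" using cov by (auto simp: K_def)
    then have "L = H" using c H \<open>finite K\<close> by (metis One_nat_def card_le_Suc0_iff_eq)
    with L show "y \<in> verts H" by simp
  qed
  then show ?thesis using H by (auto simp: K_def)
qed

lemma join_decomposition_subset:
  assumes fin: "finite_simple_graph \<Gamma>"
    and D: "join_decomposition \<Gamma> F" and D': "join_decomposition \<Gamma> F'"
  shows "F \<subseteq> F'"
proof
  fix G assume G: "G \<in> F"
  have J: "is_join \<Gamma> F" "is_join \<Gamma> F'" using D D' by (auto simp: join_decomposition_def)
  obtain H where H: "H \<in> F'" "verts G \<subseteq> verts H"
    using indecomposable_factor_subset[OF fin J G] D G by (auto simp: join_decomposition_def)
  obtain L where L: "L \<in> F" "verts H \<subseteq> verts L"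
    using indecomposable_factor_subset[OF fin J(2,1) H(1)] D' H by (auto simp: join_decomposition_def)
  have "verts G \<noteq> {}" using J G by (simp add: is_join_def)
  then have "verts G \<inter> verts L \<noteq> {}" using H L by blast
  then have "G = L" by (rule join_factors_eqI[OF J(1) G L(1)])
  then have "verts G = verts H" using H L by simp
  moreover from this have "edges G = edges H"
    using join_factor_edges[OF J(1) G] join_factor_edges[OF J(2) H(1)] by simp
  ultimately have "G = H" by simp
  with H(1) show "G \<in> F'" by simp
qed

lemma join_decomposition_ex1:
  assumes "finite_simple_graph \<Gamma>"
  shows "\<exists>!F. join_decomposition \<Gamma> F"
  using join_decomposition_exists[OF assms] join_decomposition_subset[OF assms] by blast


section \<open>Groups given by generators and relations\<close>

text \<open>A letter \<open>(a, True)\<close> stands for the generator \<open>a\<close>, and \<open>(a, False)\<close> for its inverse.\<close>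

type_synonym 'a word = "('a \<times> bool) list"

definition words :: "'a set \<Rightarrow> 'a word set" where
  "words S = lists (S \<times> UNIV)"

text \<open>A relation \<open>u = v\<close> is given as the pair \<open>(u, v)\<close>.\<close>

inductive word_eq :: "'a set \<Rightarrow> ('a word \<times> 'a word) set \<Rightarrow> 'a word \<Rightarrow> 'a word \<Rightarrow> bool"
  for S R where
  refl: "w \<in> words S \<Longrightarrow> word_eq S R w w"
| sym: "word_eq S R u v \<Longrightarrow> word_eq S R v u"
| trans: "word_eq S R u v \<Longrightarrow> word_eq S R v w \<Longrightarrow> word_eq S R u w"
| append: "word_eq S R u v \<Longrightarrow> word_eq S R u' v' \<Longrightarrow> word_eq S R (u @ u') (v @ v')"
| cancel: "a \<in> S \<Longrightarrow> word_eq S R [(a, b), (a, \<not> b)] []"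
| relation: "(u, v) \<in> R \<Longrightarrow> u \<in> words S \<Longrightarrow> v \<in> words S \<Longrightarrow> word_eq S R u v"

definition word_class :: "'a set \<Rightarrow> ('a word \<times> 'a word) set \<Rightarrow> 'a word \<Rightarrow> 'a word set" where
  "word_class S R w = {v. word_eq S R w v}"

definition presented_group :: "'a set \<Rightarrow> ('a word \<times> 'a word) set \<Rightarrow> 'a word set monoid" where
  "presented_group S R =
     \<lparr>carrier = word_class S R ` words S,
      monoid.mult = (\<lambda>A B. \<Union>u\<in>A. \<Union>v\<in>B. word_class S R (u @ v)),
      monoid.one = word_class S R []\<rparr>"

lemma word_eq_words: "word_eq S R u v \<Longrightarrow> u \<in> words S \<and> v \<in> words S"
  by (induction rule: word_eq.induct) (auto simp: words_def)

lemma word_class_eq: "word_eq S R u v \<Longrightarrow> word_class S R u = word_class S R v"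
  unfolding word_class_def by (auto intro: word_eq.sym word_eq.trans)

lemma presented_group_mult:
  assumes "u \<in> words S" "v \<in> words S"
  shows "word_class S R u \<otimes>\<^bsub>presented_group S R\<^esub> word_class S R v = word_class S R (u @ v)"
proof -
  have e: "word_class S R (u' @ v') = word_class S R (u @ v)"
    if "u' \<in> word_class S R u" "v' \<in> word_class S R v" for u' v'
    using that by (intro word_class_eq word_eq.append) (auto simp: word_class_def intro: word_eq.sym)
  have "u \<in> word_class S R u" "v \<in> word_class S R v"
    using assms by (auto simp: word_class_def intro: word_eq.refl)
  then have "(\<Union>u'\<in>word_class S R u. \<Union>v'\<in>word_class S R v. word_class S R (u' @ v')) =
      word_class S R (u @ v)"
    using e by blast
  then show ?thesis
    by (simp add: presented_group_def)
qed

lemma inverse_words: "w \<in> words S \<Longrightarrow> rev (map (apsnd Not) w) \<in> words S"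
  unfolding words_def lists_eq_set by fastforce

lemma word_inverse:
  "w \<in> words S \<Longrightarrow> word_eq S R (rev (map (apsnd Not) w) @ w) []"
proof (induction w)
  case Nil
  then show ?case by (simp add: word_eq.refl)
next
  case (Cons x w)
  obtain a b where x: "x = (a, b)" by (cases x)
  have a: "a \<in> S" and w: "w \<in> words S" using Cons.prems by (simp_all add: words_def x lists_eq_set)
  have i: "rev (map (apsnd Not) w) \<in> words S" using w by (rule inverse_words)
  have "word_eq S R [(a, \<not> b), (a, b)] []"
    using word_eq.cancel[OF a, of R "\<not> b"] by simp
  from word_eq.append[OF word_eq.refl[OF i] word_eq.append[OF this word_eq.refl[OF w]]]
  have "word_eq S R (rev (map (apsnd Not) (x # w)) @ x # w) (rev (map (apsnd Not) w) @ w)"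
    by (simp add: x)
  then show ?case using Cons.IH[OF w] by (rule word_eq.trans)
qed

lemma group_presented_group: "group (presented_group S R)"
proof (rule groupI)
  let ?G = "presented_group S R"
  have car: "carrier ?G = word_class S R ` words S" and one: "\<one>\<^bsub>?G\<^esub> = word_class S R []"
    by (auto simp: presented_group_def)
  have nil: "[] \<in> words S" by (simp add: words_def)
  have app: "u \<in> words S \<Longrightarrow> v \<in> words S \<Longrightarrow> u @ v \<in> words S" for u v
    by (simp add: words_def)
  show "x \<otimes>\<^bsub>?G\<^esub> y \<in> carrier ?G" if "x \<in> carrier ?G" "y \<in> carrier ?G" for x y
    using that by (auto simp: car presented_group_mult app)
  show "\<one>\<^bsub>?G\<^esub> \<in> carrier ?G" using nil by (auto simp: car one)
  show "x \<otimes>\<^bsub>?G\<^esub> y \<otimes>\<^bsub>?G\<^esub> z = x \<otimes>\<^bsub>?G\<^esub> (y \<otimes>\<^bsub>?G\<^esub> z)"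
    if "x \<in> carrier ?G" "y \<in> carrier ?G" "z \<in> carrier ?G" for x y z
    using that by (auto simp: car presented_group_mult app)
  show "\<one>\<^bsub>?G\<^esub> \<otimes>\<^bsub>?G\<^esub> x = x" if "x \<in> carrier ?G" for x
    using that nil by (auto simp: car one presented_group_mult)
  show "\<exists>y\<in>carrier ?G. y \<otimes>\<^bsub>?G\<^esub> x = \<one>\<^bsub>?G\<^esub>" if x: "x \<in> carrier ?G" for x
  proof -
    obtain w where w: "w \<in> words S" "x = word_class S R w" using x by (auto simp: car)
    have i: "rev (map (apsnd Not) w) \<in> words S" using w(1) by (rule inverse_words)
    have "word_class S R (rev (map (apsnd Not) w)) \<otimes>\<^bsub>?G\<^esub> x = \<one>\<^bsub>?G\<^esub>"
      by (simp add: w(2) presented_group_mult[OF i w(1)] one word_class_eq[OF word_inverse[OF w(1)]])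
    then show ?thesis using i by (auto simp: car)
  qed
qed

definition center :: "('a, 'b) monoid_scheme \<Rightarrow> 'a set" where
  "center G = {z \<in> carrier G. \<forall>g\<in>carrier G. z \<otimes>\<^bsub>G\<^esub> g = g \<otimes>\<^bsub>G\<^esub> z}"

definition torsion_free :: "('a, 'b) monoid_scheme \<Rightarrow> bool" where
  "torsion_free G \<longleftrightarrow>
     (\<forall>x\<in>carrier G. \<forall>n::nat. 0 < n \<and> x [^]\<^bsub>G\<^esub> n = \<one>\<^bsub>G\<^esub> \<longrightarrow> x = \<one>\<^bsub>G\<^esub>)"


section \<open>Artin groups\<close>

fun alternating_word :: "nat \<Rightarrow> 'v \<Rightarrow> 'v \<Rightarrow> 'v word" where
  "alternating_word 0 s t = []"
| "alternating_word (Suc n) s t = (s, True) # alternating_word n t s"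

definition artin_relations :: "'v sgraph \<Rightarrow> ('v set \<Rightarrow> nat) \<Rightarrow> ('v word \<times> 'v word) set" where
  "artin_relations \<Gamma> \<mu> =
     {(alternating_word (\<mu> {s, t}) s t, alternating_word (\<mu> {s, t}) t s) | s t. {s, t} \<in> edges \<Gamma>}"

definition artin_group :: "'v sgraph \<Rightarrow> ('v set \<Rightarrow> nat) \<Rightarrow> 'v word set monoid" where
  "artin_group \<Gamma> \<mu> = presented_group (verts \<Gamma>) (artin_relations \<Gamma> \<mu>)"

definition artin_generator :: "'v sgraph \<Rightarrow> ('v set \<Rightarrow> nat) \<Rightarrow> 'v \<Rightarrow> 'v word set" where
  "artin_generator \<Gamma> \<mu> v = word_class (verts \<Gamma>) (artin_relations \<Gamma> \<mu>) [(v, True)]"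

text \<open>
  For a subgraph \<open>\<Delta>\<close> of \<open>\<Gamma>\<close>, the subgroup \<open>A\<^sub>\<Delta>\<close> of \<open>A\<^sub>\<Gamma>\<close> generated by the vertices of \<open>\<Delta>\<close>.
\<close>

definition artin_subgroup ::
    "'v sgraph \<Rightarrow> ('v set \<Rightarrow> nat) \<Rightarrow> 'v sgraph \<Rightarrow> 'v word set monoid" where
  "artin_subgroup \<Gamma> \<mu> \<Delta> =
     subgroup_generated (artin_group \<Gamma> \<mu>) (artin_generator \<Gamma> \<mu> ` verts \<Delta>)"

definition coxeter_graph :: "'v sgraph \<Rightarrow> ('v set \<Rightarrow> nat) \<Rightarrow> 'v sgraph" where
  "coxeter_graph \<Gamma> \<mu> =
     \<lparr>verts = verts \<Gamma>,
      edges = {{s, t} | s t. s \<in> verts \<Gamma> \<and> t \<in> verts \<Gamma> \<and> s \<noteq> t \<and>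
                 ({s, t} \<notin> edges \<Gamma> \<or> 3 \<le> \<mu> {s, t})}\<rparr>"

definition artin_irreducible :: "'v sgraph \<Rightarrow> ('v set \<Rightarrow> nat) \<Rightarrow> bool" where
  "artin_irreducible \<Gamma> \<mu> \<longleftrightarrow> graph_connected (coxeter_graph \<Gamma> \<mu>)"

end

(* The center of A is in fact trivial. Let s and t be non-adjacent vertices. Every defining relation
   avoids s or t, so A is the amalgamated product of the subgroups generated by V - {s} and V - {t},
   and a central element lies in one of the two factors.

   Let z be a central element in the subgroup A_T generated by T, and let s be a vertex outside T.
   The group A acts on A x (right cosets of W_T in W), where W is the Coxeter group: this is the set-theoretic
   retraction of A onto A_T. Comparing the actions of z and s z s^-1 on the base point shows that
   z already lies in the subgroup generated by those x in T that are joined to s by an edge with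
   label 2. If A is irreducible, such an s can be chosen to make T smaller as long as T is not empty,
   and thus z = 1. *)
theory Submission
  imports Defs
begin

section \<open>The reflection representation of a Coxeter group\<close>

text \<open>The retraction onto A_T is not a homomorphism, so it is built as an action: letters must
  act invertibly, and the two sides of each braid relation must act alike. The first component of a
  state lives in A itself, where A_T is the set of classes of words over T. The Coxeter group is
  handled through its reflection representation; what makes the action work is that the coordinates
  of every root have one sign, so that a generator v fixes the coset of w exactly when w sends a
  simple root of T to the simple root of v. Label 2 arises from the coordinate at s. The generator s
  moves the base chamber to \<open>refl s\<close>, and there the image of the simple root of x has
  s-coordinate \<open>coef s x\<close> = 2 cos(pi/m), which for x \<noteq> s vanishes exactly for m
  = 2. Letters of T never alter this coordinate, while a letter of T can fix a chamber only through
  a root whose s-coordinate is zero. So only the x with \<open>coef s x = 0\<close> are recorded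
  while z is read from that chamber.\<close>

text \<open>The label \<open>0\<close> stands for \<open>\<infinity>\<close>: since \<open>x / 0 = 0\<close>, the definition of \<open>coef\<close> below then gives
  \<open>2 * cos 0 = 2\<close>. With \<open>m s s = 1\<close> it gives \<open>-2\<close>, so that \<open>coef\<close> is \<open>-2\<close> times the usual
  bilinear form of the Coxeter matrix.\<close>

locale coxeter_matrix =
  fixes S :: "'v set" and m :: "'v \<Rightarrow> 'v \<Rightarrow> nat"
  assumes finite_S: "finite S"
    and m_diag: "m s s = 1"
    and m_sym: "m s t = m t s"
    and m_off_diag: "s \<noteq> t \<Longrightarrow> m s t \<noteq> 1"
begin

definition coef :: "'v \<Rightarrow> 'v \<Rightarrow> real" where
  "coef s t = 2 * cos (pi / m s t)"

definition simple :: "'v \<Rightarrow> 'v \<Rightarrow> real" where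
  "simple s = (\<lambda>u. if u = s then 1 else 0)"

text \<open>This is -2B(s, f) for the usual bilinear form B, so the reflection f - 2B(s, f)s takes a
  plus sign in \<open>refl\<close>, and \<open>form\<close> has the value -2 on every root.\<close>

definition pairing :: "'v \<Rightarrow> ('v \<Rightarrow> real) \<Rightarrow> real" where
  "pairing s f = (\<Sum>u\<in>S. coef s u * f u)"

definition refl :: "'v \<Rightarrow> ('v \<Rightarrow> real) \<Rightarrow> 'v \<Rightarrow> real" where
  "refl s f = f(s := f s + pairing s f)"

definition form :: "('v \<Rightarrow> real) \<Rightarrow> ('v \<Rightarrow> real) \<Rightarrow> real" where
  "form f g = (\<Sum>s\<in>S. f s * pairing s g)"

abbreviation lincomb :: "real \<Rightarrow> ('v \<Rightarrow> real) \<Rightarrow> real \<Rightarrow> ('v \<Rightarrow> real) \<Rightarrow> 'v \<Rightarrow> real" where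
  "lincomb a f b g \<equiv> (\<lambda>u. a * f u + b * g u)"

fun refls :: "'v list \<Rightarrow> ('v \<Rightarrow> real) \<Rightarrow> 'v \<Rightarrow> real" where
  "refls [] = id"
| "refls (v # ws) = refl v \<circ> refls ws"

text \<open>Composite of \<open>n\<close> alternating reflections, of which \<open>refl s\<close> is applied first.\<close>

fun alt :: "nat \<Rightarrow> 'v \<Rightarrow> 'v \<Rightarrow> ('v \<Rightarrow> real) \<Rightarrow> 'v \<Rightarrow> real" where
  "alt 0 s t = id"
| "alt (Suc n) s t = alt n t s \<circ> refl s"

definition nonneg :: "('v \<Rightarrow> real) \<Rightarrow> bool" where
  "nonneg f \<longleftrightarrow> (\<forall>u. 0 \<le> f u)"

lemma coef_diag [simp]: "coef s s = -2"
  by (simp add: coef_def m_diag)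

lemma coef_sym: "coef s t = coef t s"
  by (simp add: coef_def m_sym)

lemma m_ge_2: "s \<noteq> t \<Longrightarrow> m s t \<noteq> 0 \<Longrightarrow> 2 \<le> m s t"
  using m_off_diag[of s t] by linarith

lemma sin_pos_m: "s \<noteq> t \<Longrightarrow> m s t \<noteq> 0 \<Longrightarrow> 0 < sin (pi / m s t)"
  using m_ge_2[of s t] by (intro sin_gt_zero) (auto simp: field_simps)

lemma pairing_lincomb: "pairing s (lincomb a f b g) = a * pairing s f + b * pairing s g"
  by (simp add: pairing_def sum.distrib sum_distrib_left algebra_simps)

lemma pairing_simple: "t \<in> S \<Longrightarrow> pairing s (simple t) = coef s t"
  using finite_S by (simp add: pairing_def simple_def if_distrib cong: if_cong)

lemma form_simple: "s \<in> S \<Longrightarrow> form (simple s) g = pairing s g"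
  using finite_S by (simp add: form_def simple_def if_distrib[where f = "\<lambda>x. x * _"] cong: if_cong)

lemma form_lincomb_left: "form (lincomb a f b g) h = a * form f h + b * form g h"
  by (simp add: form_def sum.distrib sum_distrib_left algebra_simps)

lemma form_sym: "form f g = form g f"
proof -
  have "form f g = (\<Sum>s\<in>S. \<Sum>u\<in>S. f s * coef s u * g u)"
    by (simp add: form_def pairing_def sum_distrib_left mult.assoc)
  also have "\<dots> = (\<Sum>u\<in>S. \<Sum>s\<in>S. f s * coef s u * g u)"
    by (rule sum.swap)
  also have "\<dots> = form g f"
    by (simp add: form_def pairing_def sum_distrib_left mult.assoc mult.commute mult.left_commute coef_sym)
  finally show ?thesis .
qed

lemma refl_eq: "refl s f = lincomb 1 f (pairing s f) (simple s)"
  by (auto simp: refl_def simple_def)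

lemma refl_lincomb: "refl s (lincomb a f b g) = lincomb a (refl s f) b (refl s g)"
  unfolding refl_def pairing_lincomb by (auto simp: algebra_simps)

lemma pairing_refl: "s \<in> S \<Longrightarrow> pairing t (refl s f) = pairing t f + pairing s f * coef t s"
  unfolding refl_eq pairing_lincomb by (simp add: pairing_simple)

lemma refl_refl: "s \<in> S \<Longrightarrow> refl s (refl s f) = f"
  by (subst refl_def) (simp add: pairing_refl, simp add: refl_def)

lemma refl_comp: "s \<in> S \<Longrightarrow> refl s \<circ> refl s = id"
  by (auto simp: refl_refl)

lemma form_refl_left: "s \<in> S \<Longrightarrow> form (refl s f) g = form f g + pairing s f * pairing s g"
  unfolding refl_eq form_lincomb_left by (simp add: form_simple)

lemma form_refl: "s \<in> S \<Longrightarrow> form (refl s f) (refl s g) = form f g"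
  by (simp add: form_refl_left pairing_refl form_sym[of f] algebra_simps)

lemma refls_append: "refls (u @ w) = refls u \<circ> refls w"
  by (induction u) auto

lemma refls_lincomb: "refls w (lincomb a f b g) = lincomb a (refls w f) b (refls w g)"
  by (induction w) (auto simp: refl_lincomb)

lemma refls_rev: "w \<in> lists S \<Longrightarrow> refls (rev w) (refls w f) = f"
  by (induction w arbitrary: f) (auto simp: refls_append refl_refl)

lemma refls_rev_right: "w \<in> lists S \<Longrightarrow> refls w (refls (rev w) f) = f"
  using refls_rev[of "rev w" f] by (simp add: in_lists_conv_set)

lemma form_refls: "w \<in> lists S \<Longrightarrow> form (refls w f) (refls w g) = form f g"
  by (induction w) (auto simp: form_refl)

lemma simple_inject [simp]: "simple s = simple t \<longleftrightarrow> s = t"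
  by (auto simp: simple_def fun_eq_iff split: if_splits)

lemma refls_inj: "w \<in> lists S \<Longrightarrow> refls w f = refls w g \<Longrightarrow> f = g"
  using refls_rev by metis

lemma refl_simple: "s \<in> S \<Longrightarrow> refl s (simple s) = lincomb (-1) (simple s) 0 (simple s)"
  by (simp add: refl_eq pairing_simple)

lemma refl_other: "u \<noteq> s \<Longrightarrow> refl s f u = f u"
  by (simp add: refl_def)

section \<open>The plane of two simple roots and the braid relation\<close>

lemma refl_plane:
  assumes "s \<in> S" "t \<in> S" "s \<noteq> t"
  shows "refl s (lincomb a (simple s) b (simple t)) = lincomb (coef s t * b - a) (simple s) b (simple t)"
  unfolding refl_eq pairing_lincomb using assms by (auto simp: pairing_simple algebra_simps)

text \<open>Each reflection replaces one of the two coordinates, the older one, by the next term of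
  the recurrence. The coordinates are thus always two consecutive terms, and the parity of
  \<open>n\<close> tells which of them belongs to \<open>s\<close>.\<close>

lemma alt_plane:
  assumes "s \<in> S" "t \<in> S" "s \<noteq> t" and G: "\<And>j. G (j + 2) = coef s t * G (j + 1) - G j"
  shows "alt n s t (lincomb (G 0) (simple s) (G 1) (simple t)) =
     (if even n then lincomb (G n) (simple s) (G (n + 1)) (simple t)
      else lincomb (G (n + 1)) (simple s) (G n) (simple t))"
  using assms
proof (induction n arbitrary: s t G)
  case (Suc n)
  have "refl s (lincomb (G 0) (simple s) (G 1) (simple t)) = lincomb (G (0 + 1)) (simple t) (G (1 + 1)) (simple s)"
    using Suc.prems(4)[of 0] Suc.prems by (simp add: refl_plane numeral_2_eq_2) (simp add: add.commute)
  then have "alt (Suc n) s t (lincomb (G 0) (simple s) (G 1) (simple t)) =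
      alt n t s (lincomb (G (0 + 1)) (simple t) (G (1 + 1)) (simple s))"
    by (simp only: alt.simps comp_apply)
  also have "\<dots> =
     (if even n then lincomb (G (n + 1)) (simple t) (G (n + 1 + 1)) (simple s)
      else lincomb (G (n + 1 + 1)) (simple t) (G (n + 1)) (simple s))"
    using Suc.prems coef_sym[of s t] by (intro Suc.IH[where G = "\<lambda>j. G (j + 1)"]) (auto simp: add.commute add.left_commute)
  finally show ?case
    by (simp add: add.commute)
qed auto

text \<open>The solution of G(j+2) = 2 cos \<theta> G(j+1) - G(j) with G(0) = a and G(1) = b, valid
  when sin \<theta> \<noteq> 0. The angle 0 of an infinite label is excluded; there the solutions
  are linear in j.\<close>

definition dihedral_seq :: "real \<Rightarrow> real \<Rightarrow> real \<Rightarrow> nat \<Rightarrow> real" where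
  "dihedral_seq \<theta> a b j = (b * sin (real j * \<theta>) - a * sin (real j * \<theta> - \<theta>)) / sin \<theta>"

lemma dihedral_seq_rec:
  assumes "sin \<theta> \<noteq> 0"
  shows "dihedral_seq \<theta> a b 0 = a" "dihedral_seq \<theta> a b 1 = b"
    "dihedral_seq \<theta> a b (j + 2) = 2 * cos \<theta> * dihedral_seq \<theta> a b (j + 1) - dihedral_seq \<theta> a b j"
proof -
  show "dihedral_seq \<theta> a b 0 = a" "dihedral_seq \<theta> a b 1 = b"
    using assms by (auto simp: dihedral_seq_def)
  have r: "sin (x + 2 * \<theta>) = 2 * cos \<theta> * sin (x + \<theta>) - sin x" for x
    using sin_add[of "x + \<theta>" \<theta>] sin_diff[of "x + \<theta>" \<theta>] by (simp add: algebra_simps)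
  have 1: "sin (real (j + 2) * \<theta>) = 2 * cos \<theta> * sin (real (j + 1) * \<theta>) - sin (real j * \<theta>)"
    using r[of "real j * \<theta>"] by (simp add: algebra_simps)
  have 2: "sin (real (j + 2) * \<theta> - \<theta>) = 2 * cos \<theta> * sin (real (j + 1) * \<theta> - \<theta>) - sin (real j * \<theta> - \<theta>)"
    using r[of "real j * \<theta> - \<theta>"] by (simp add: algebra_simps)
  show "dihedral_seq \<theta> a b (j + 2) = 2 * cos \<theta> * dihedral_seq \<theta> a b (j + 1) - dihedral_seq \<theta> a b j"
    unfolding dihedral_seq_def 1 2 using assms by (simp add: field_simps)
qed

lemma alt_plane_seq:
  fixes a b :: real
  assumes "s \<in> S" "t \<in> S" "s \<noteq> t" "m s t \<noteq> 0"
  defines "G \<equiv> dihedral_seq (pi / m s t) a b"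
  shows "alt n s t (lincomb a (simple s) b (simple t)) =
     (if even n then lincomb (G n) (simple s) (G (n + 1)) (simple t)
      else lincomb (G (n + 1)) (simple s) (G n) (simple t))"
proof -
  have ns: "sin (pi / m s t) \<noteq> 0" using sin_pos_m assms by force
  show ?thesis
    using alt_plane[OF assms(1-3), of G n] dihedral_seq_rec[OF ns]
    by (simp add: G_def coef_def)
qed

lemma dihedral_seq_period:
  assumes "k \<noteq> 0" "sin (pi / real k) \<noteq> 0"
  shows "dihedral_seq (pi / k) a b k = - a" "dihedral_seq (pi / k) a b (k + 1) = - b"
proof -
  have "sin (pi + pi / real k) = - sin (pi / real k)" by simp
  moreover have "real (k + 1) * (pi / real k) = pi + pi / real k" "real k * (pi / real k) = pi"
    using assms by (simp_all add: field_simps)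
  moreover have "sin (pi - pi / real k) = sin (pi / real k)" by simp
  ultimately show "dihedral_seq (pi / k) a b k = - a" "dihedral_seq (pi / k) a b (k + 1) = - b"
    using assms unfolding dihedral_seq_def by auto
qed

text \<open>The longest element of the dihedral group: since m times the angle pi/m is pi, it acts
  on the plane as -1, combined with the exchange of the two simple roots when m is odd. This is
  symmetric in \<open>s\<close> and \<open>t\<close>.\<close>

lemma alt_plane_full:
  assumes "s \<in> S" "t \<in> S" "s \<noteq> t" "m s t \<noteq> 0"
  shows "alt (m s t) s t (lincomb a (simple s) b (simple t)) =
     (if even (m s t) then lincomb (-a) (simple s) (-b) (simple t)
      else lincomb (-b) (simple s) (-a) (simple t))"
  using dihedral_seq_period[of "m s t" a b] sin_pos_m[of s t] assms
  by (simp add: alt_plane_seq)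

lemma alt_lincomb: "alt n s t (lincomb a f b g) = lincomb a (alt n s t f) b (alt n s t g)"
  by (induction n arbitrary: s t f g) (auto simp: refl_lincomb)

lemma alt_fixed: "refl s h = h \<Longrightarrow> refl t h = h \<Longrightarrow> alt n s t h = h"
  by (induction n arbitrary: s t) auto

text \<open>Every vector is the sum of a vector \<open>p\<close> in the plane of \<open>s\<close>
  and \<open>t\<close> and a vector \<open>h\<close> fixed by both reflections, because the Gram
  determinant \<open>D\<close> is nonzero for a finite label. On the plane both sides are the
  longest element.\<close>

lemma alt_braid:
  assumes st: "s \<in> S" "t \<in> S" "s \<noteq> t" "m s t \<noteq> 0"
  shows "alt (m s t) s t = alt (m s t) t s"
proof
  fix f
  define c where "c = coef s t"
  define D where "D = 4 - c\<^sup>2"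
  have "D = (2 * sin (pi / m s t))\<^sup>2"
    by (simp add: D_def c_def coef_def power_mult_distrib sin_squared_eq)
  then have D: "D \<noteq> 0" using sin_pos_m[OF st(3,4)] by simp
  \<comment> \<open>Cramer's rule for the system c b - 2 a = \<open>pairing s f\<close>, c a - 2 b =
    \<open>pairing t f\<close>, which says that \<open>p\<close> has the same pairings with
    \<open>s\<close> and \<open>t\<close> as \<open>f\<close>.\<close>
  define a b where "a = - (2 * pairing s f + c * pairing t f) / D"
    and "b = - (c * pairing s f + 2 * pairing t f) / D"
  define p where "p = lincomb a (simple s) b (simple t)"
  define h where "h = lincomb 1 f (-1) p"
  have "pairing s p = c * b - 2 * a" "pairing t p = c * a - 2 * b"
    using st coef_sym[of s t] by (simp_all add: p_def pairing_lincomb pairing_simple c_def)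
  moreover have "c * b - 2 * a = D * pairing s f / D" "c * a - 2 * b = D * pairing t f / D"
    unfolding a_def b_def D_def power2_eq_square by (simp_all add: diff_divide_distrib[symmetric] algebra_simps add_divide_distrib[symmetric])
  ultimately have "pairing s h = 0" "pairing t h = 0"
    using D pairing_lincomb[of s 1 f "-1" p] pairing_lincomb[of t 1 f "-1" p] by (simp_all add: h_def)
  then have h: "refl s h = h" "refl t h = h" by (simp_all add: refl_def)
  have f: "f = lincomb 1 h 1 p" by (auto simp: h_def)
  have p': "p = lincomb b (simple t) a (simple s)" by (auto simp: p_def)
  have "alt (m s t) s t p = alt (m t s) t s p"
    unfolding p_def alt_plane_full[OF st]
    using alt_plane_full[of t s b a] st m_sym[of s t] by (auto simp: add.commute)
  then have "alt (m s t) s t (lincomb 1 h 1 p) = alt (m s t) t s (lincomb 1 h 1 p)"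
    unfolding alt_lincomb by (simp add: alt_fixed h m_sym)
  then show "alt (m s t) s t f = alt (m s t) t s f"
    by (simp only: f[symmetric])
qed

section \<open>The reflection group and its word length\<close>

definition weyl :: "'v set \<Rightarrow> (('v \<Rightarrow> real) \<Rightarrow> 'v \<Rightarrow> real) set" where
  "weyl T = refls ` lists T"

text \<open>The generating set is a parameter because positivity of roots compares the length over
  all generators with the length in a dihedral subgroup.\<close>

definition len :: "'v set \<Rightarrow> (('v \<Rightarrow> real) \<Rightarrow> 'v \<Rightarrow> real) \<Rightarrow> nat" where
  "len T w = (LEAST n. \<exists>ws\<in>lists T. length ws = n \<and> refls ws = w)"

lemma weyl_id: "id \<in> weyl T"
  by (force simp: weyl_def intro: image_eqI[of _ _ "[]"])

lemma weyl_comp: "u \<in> weyl T \<Longrightarrow> w \<in> weyl T \<Longrightarrow> u \<circ> w \<in> weyl T"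
proof -
  assume "u \<in> weyl T" "w \<in> weyl T"
  then obtain us ws where "us @ ws \<in> lists T" "u \<circ> w = refls (us @ ws)"
    by (auto simp: weyl_def refls_append)
  then show ?thesis unfolding weyl_def by blast
qed

lemma weyl_refl: "s \<in> T \<Longrightarrow> refl s \<in> weyl T"
  by (force simp: weyl_def intro: image_eqI[of _ _ "[s]"])

lemma weyl_mono: "T \<subseteq> U \<Longrightarrow> weyl T \<subseteq> weyl U"
  unfolding weyl_def by (meson image_mono lists_mono)

lemma weyl_lincomb: "w \<in> weyl T \<Longrightarrow> w (lincomb a f b g) = lincomb a (w f) b (w g)"
  by (auto simp: weyl_def refls_lincomb)

lemma len_le: "ws \<in> lists T \<Longrightarrow> len T (refls ws) \<le> length ws"
  unfolding len_def by (rule Least_le) auto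

lemma reduced_word:
  assumes "w \<in> weyl T"
  obtains ws where "ws \<in> lists T" "length ws = len T w" "refls ws = w"
proof -
  have "\<exists>n. \<exists>ws\<in>lists T. length ws = n \<and> refls ws = w"
    using assms by (auto simp: weyl_def)
  from LeastI_ex[OF this] show ?thesis using that unfolding len_def by blast
qed

lemma len_comp_le: "u \<in> weyl T \<Longrightarrow> w \<in> weyl T \<Longrightarrow> len T (u \<circ> w) \<le> len T u + len T w"
  by (elim reduced_word) (metis append_in_lists_conv len_le length_append refls_append)

lemma len_refl_le: "s \<in> T \<Longrightarrow> len T (refl s) \<le> 1"
  using len_le[of "[s]" T] by simp

lemma len_mono: "T \<subseteq> U \<Longrightarrow> w \<in> weyl T \<Longrightarrow> len U w \<le> len T w"
  by (elim reduced_word) (metis len_le lists_mono subsetD)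

lemma weyl_inverse:
  assumes "T \<subseteq> S" "w \<in> weyl T"
  obtains w' where "w' \<in> weyl T" "w' \<circ> w = id" "w \<circ> w' = id"
proof -
  obtain ws where ws: "ws \<in> lists T" "w = refls ws" using assms by (auto simp: weyl_def)
  then have "ws \<in> lists S" using assms lists_mono by blast
  then have "refls (rev ws) \<circ> w = id" "w \<circ> refls (rev ws) = id"
    using ws refls_rev[of ws] refls_rev_right[of ws] by (simp_all add: comp_def id_def)
  moreover have "refls (rev ws) \<in> weyl T" using ws by (auto simp: weyl_def)
  ultimately show ?thesis using that by blast
qed

section \<open>Alternating products in dihedral subgroups\<close>

lemma alt_Suc_end: "alt (Suc n) s t = refl (if even n then s else t) \<circ> alt n s t"
  by (induction n arbitrary: s t) (auto simp: fun_eq_iff)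

lemma alt_word: "\<exists>ws\<in>lists {s, t}. length ws = n \<and> refls ws = alt n s t"
proof (induction n)
  case 0
  show ?case by (force intro: bexI[of _ "[]"])
next
  case (Suc n)
  then obtain ws where "ws \<in> lists {s, t}" "length ws = n" "refls ws = alt n s t" by blast
  then show ?case
    by (intro bexI[of _ "(if even n then s else t) # ws"]) (auto simp: alt_Suc_end simp del: alt.simps)
qed

lemma alt_weyl: "alt n s t \<in> weyl {s, t}"
  using alt_word[of s t n] by (metis image_eqI weyl_def)

lemma len_alt: "len {s, t} (alt n s t) \<le> n"
  using alt_word[of s t n] len_le by metis

text \<open>A letter put in front of an alternating product either prolongs the alternation or
  cancels the outermost reflection.\<close>

lemma dihedral_word:
  assumes "s \<in> S" "t \<in> S" "ws \<in> lists {s, t}"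
  shows "\<exists>n \<le> length ws. refls ws = alt n s t \<or> refls ws = alt n t s"
  using assms(3)
proof (induction ws rule: list.induct)
  case (Cons v ws)
  then obtain n x y where n: "n \<le> length ws" "refls ws = alt n x y" and xy: "(x, y) = (s, t) \<or> (x, y) = (t, s)"
    by auto
  consider "n = 0" | "0 < n" "v = (if even n then x else y)" | k where "n = Suc k" "v = (if even k then x else y)"
    using Cons.prems xy by (cases n; cases "even (n - 1)") auto
  then show ?case
  proof cases
    case 1
    have "refl v = alt 1 v y" for y by simp
    then show ?thesis using 1 Cons.prems n by (intro exI[of _ 1]) auto
  next
    case 2
    then have "refls (v # ws) = alt (Suc n) x y" using n by (simp add: alt_Suc_end del: alt.simps)
    then show ?thesis using xy n by (intro exI[of _ "Suc n"]) (auto simp del: alt.simps refls.simps)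
  next
    case 3
    then have "v \<in> S" using xy assms by auto
    then have "refls (v # ws) = alt k x y"
      using n 3 by (simp add: alt_Suc_end o_assoc refl_comp del: alt.simps)
    then show ?thesis using xy n 3 by (intro exI[of _ k]) (auto simp del: refls.simps)
  qed
qed (auto intro: exI[of _ 0])

lemma alt_add: "alt (n + k) s t = (if even n then alt k s t else alt k t s) \<circ> alt n s t"
  by (induction n arbitrary: s t) (auto simp: o_assoc)

section \<open>Positivity of roots\<close>

lemma dihedral_seq_nonneg:
  assumes "j \<le> k" "1 < k"
  shows "0 \<le> dihedral_seq (pi / real k) 0 1 j"
proof -
  have "real j * (pi / real k) \<le> real k * (pi / real k)"
    using assms by (intro mult_right_mono) auto
  then have "0 \<le> sin (real j * (pi / real k))"
    using assms by (intro sin_ge_zero) auto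
  moreover have "0 < sin (pi / real k)"
    using assms by (intro sin_gt_zero) (auto simp: field_simps)
  ultimately show ?thesis by (simp add: dihedral_seq_def)
qed

text \<open>As \<open>refl s\<close> does not shorten \<open>u\<close>, a reduced alternating
  product for \<open>u\<close> applies \<open>refl t\<close> first. For a finite label it has fewer
  than m factors, since otherwise a braid relation would let it apply \<open>refl s\<close> first.
  The coordinates of the image are then sines of angles in [0, pi], divided by sin(pi/m).\<close>

lemma dihedral_nonneg:
  assumes st: "s \<in> S" "t \<in> S" "s \<noteq> t" and u: "u \<in> weyl {s, t}"
    and l: "len {s, t} u \<le> len {s, t} (u \<circ> refl s)"
  shows "\<exists>a b. 0 \<le> a \<and> 0 \<le> b \<and> u (simple s) = lincomb a (simple s) b (simple t)"
proof -
  obtain ws where ws: "ws \<in> lists {s, t}" "length ws = len {s, t} u" "refls ws = u"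
    using reduced_word[OF u] by blast
  obtain n where n: "n \<le> length ws" "u = alt n s t \<or> u = alt n t s"
    using dihedral_word[OF st(1,2) ws(1)] ws(3) by blast
  have nl: "n = len {s, t} u"
    using n ws(2) len_alt[of s t n] len_alt[of t s n] by (auto simp: insert_commute)
  have ut: "u = alt n t s"
  proof (cases n)
    case (Suc k)
    show ?thesis
    proof (rule ccontr)
      assume "u \<noteq> alt n t s"
      then have "u \<circ> refl s = alt k t s"
        using n Suc st by (auto simp: comp_assoc refl_comp)
      then have "len {s, t} (u \<circ> refl s) \<le> k"
        using len_alt[of t s k] by (simp add: insert_commute)
      then show False using nl l Suc by simp
    qed
  qed (use n in auto)
  have s: "simple s = lincomb 0 (simple t) 1 (simple s)" by simp
  show ?thesis
  proof (cases "m t s = 0")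
    case True
    \<comment> \<open>For an infinite label the recurrence is G(j+2) = 2 G(j+1) - G(j), and the
      initial values 0 and 1 give G(j) = j.\<close>
    have "alt n t s (lincomb (real 0) (simple t) (real 1) (simple s)) =
     (if even n then lincomb n (simple t) (n + 1) (simple s)
      else lincomb (n + 1) (simple t) n (simple s))"
      using alt_plane[of t s real n] st True by (simp add: coef_def add.commute)
    then have "alt n t s (simple s) = (if even n then lincomb (n + 1) (simple s) n (simple t)
      else lincomb n (simple s) (n + 1) (simple t))"
      by (auto simp: fun_eq_iff)
    then show ?thesis using ut
      by (intro exI[of _ "real (if even n then n + 1 else n)"] exI[of _ "real (if even n then n else n + 1)"]) auto
  next
    case False
    let ?k = "m t s"
    have k: "1 < ?k" using False m_ge_2[of t s] st by simp
    have "n < ?k"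
    proof (rule ccontr)
      assume "\<not> n < ?k"
      then obtain j where j: "n = ?k + j" using le_Suc_ex not_less by blast
      define a where "a = (if even ?k then alt j t s else alt j s t)"
      obtain k' where k': "?k = Suc k'" using k by (cases ?k) auto
      have "u = a \<circ> alt ?k t s" unfolding ut j a_def by (simp add: alt_add)
      also have "alt ?k t s = alt ?k s t"
        using alt_braid[of t s] st False by simp
      also have "alt ?k s t = alt k' t s \<circ> refl s" by (simp add: k')
      finally have "u \<circ> refl s = a \<circ> alt k' t s" using st by (simp add: fun_eq_iff refl_refl)
      moreover have "len {s, t} a \<le> j" "a \<in> weyl {s, t}"
        using len_alt[of s t j] len_alt[of t s j] alt_weyl[of j s t] alt_weyl[of j t s]
        by (auto simp: a_def insert_commute)
      moreover have "len {s, t} (alt k' t s) \<le> k'" "alt k' t s \<in> weyl {s, t}"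
        using len_alt[of t s k'] alt_weyl[of k' t s] by (auto simp: insert_commute)
      ultimately have "len {s, t} (u \<circ> refl s) \<le> j + k'"
        using len_comp_le[of a "{s, t}" "alt k' t s"] by simp
      then show False using l nl j k' by simp
    qed
    define G where "G = dihedral_seq (pi / ?k) 0 1"
    have "0 \<le> G n" "0 \<le> G (n + 1)"
      using \<open>n < ?k\<close> k dihedral_seq_nonneg[of n ?k] dihedral_seq_nonneg[of "n + 1" ?k] by (auto simp: G_def)
    moreover have "u (simple s) = (if even n then lincomb (G (n + 1)) (simple s) (G n) (simple t)
      else lincomb (G n) (simple s) (G (n + 1)) (simple t))"
      unfolding ut using alt_plane_seq[of t s n 0 1] st False by (auto simp: G_def fun_eq_iff)
    ultimately show ?thesis by (cases "even n") auto
  qed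
qed

text \<open>Factor \<open>w = v \<circ> u\<close> with \<open>u\<close> in the dihedral group of \<open>s\<close> and the last letter \<open>t\<close> of a
  reduced word of \<open>w\<close>, and with \<open>v\<close> as short as possible.\<close>

theorem root_nonneg:
  assumes "w \<in> weyl S" "s \<in> S" "len S w \<le> len S (w \<circ> refl s)"
  shows "nonneg (w (simple s))"
  using assms
proof (induction "len S w" arbitrary: w s rule: less_induct)
  case less
  show ?case
  proof (cases "len S w")
    case 0
    then have "w = id" using reduced_word[OF less.prems(1)] by (metis length_0_conv refls.simps(1))
    then show ?thesis by (simp add: nonneg_def simple_def)
  next
    case (Suc n)
    obtain ws where ws: "ws \<in> lists S" "length ws = len S w" "refls ws = w"
      using reduced_word[OF less.prems(1)] by blast
    then obtain us t where us: "ws = us @ [t]" using Suc by (cases ws rule: rev_cases) auto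
    then have t: "t \<in> S" and usS: "us \<in> lists S" using ws by auto
    have wt: "w \<circ> refl t = refls us" using ws us t by (auto simp: refls_append comp_assoc refl_comp)
    then have lt: "len S (w \<circ> refl t) \<le> n" using len_le[OF usS] ws us Suc by simp
    have st: "s \<noteq> t" using lt less.prems Suc by auto
    define A where "A v \<longleftrightarrow> v \<in> weyl S \<and> (\<exists>u\<in>weyl {s, t}. w = v \<circ> u \<and> len S v + len {s, t} u \<le> len S w)" for v
    have "A (refls us)"
      unfolding A_def using usS ws us len_le[OF usS] len_refl_le[of t "{s, t}"] weyl_refl[of t "{s, t}"]
      by (auto simp: weyl_def[of S] refls_append intro!: bexI[of _ "refl t"])
    define v where "v = arg_min (len S) A"
    have v: "A v" "\<And>v'. A v' \<Longrightarrow> len S v \<le> len S v'"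
      unfolding v_def using arg_min_natI[of A, OF \<open>A (refls us)\<close>] arg_min_nat_le[of A] by auto
    obtain u where u: "v \<in> weyl S" "u \<in> weyl {s, t}" "w = v \<circ> u" "len S v + len {s, t} u \<le> len S w"
      using v(1) by (auto simp: A_def)
    have lv: "len S v < len S w"
      using v(2)[OF \<open>A (refls us)\<close>] len_le[OF usS] ws us Suc by simp
    \<comment> \<open>Otherwise the letter \<open>r\<close> could be moved from \<open>v\<close>
      into \<open>u\<close>, making \<open>v\<close> shorter. With this the induction hypothesis
      applies to \<open>v\<close> at both \<open>s\<close> and \<open>t\<close>.\<close>
    have asc: "len S v \<le> len S (v \<circ> refl r)" if r: "r \<in> {s, t}" for r
    proof (rule ccontr)
      assume c: "\<not> len S v \<le> len S (v \<circ> refl r)"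
      have rS: "r \<in> S" using r t less.prems by auto
      have "A (v \<circ> refl r)"
        unfolding A_def
      proof (intro conjI bexI[of _ "refl r \<circ> u"])
        show "v \<circ> refl r \<in> weyl S" using u rS by (intro weyl_comp weyl_refl)
        show "refl r \<circ> u \<in> weyl {s, t}" using u r by (intro weyl_comp weyl_refl)
        show "w = (v \<circ> refl r) \<circ> (refl r \<circ> u)" using rS u by (simp add: fun_eq_iff refl_refl)
        have "len {s, t} (refl r \<circ> u) \<le> 1 + len {s, t} u"
          using len_comp_le[OF weyl_refl[OF r] u(2)] len_refl_le[OF r] by simp
        then show "len S (v \<circ> refl r) + len {s, t} (refl r \<circ> u) \<le> len S w"
          using c u(4) by simp
      qed
      then show False using v(2) c by blast
    qed
    have pos: "nonneg (v (simple s))" "nonneg (v (simple t))"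
      using less.hyps[OF lv u(1)] less.prems t asc by auto
    \<comment> \<open>If \<open>refl s\<close> shortened \<open>u\<close>, the factorisation would
      show that it shortens \<open>w\<close> as well.\<close>
    have "len {s, t} u \<le> len {s, t} (u \<circ> refl s)"
    proof (rule ccontr)
      assume c: "\<not> ?thesis"
      have us: "u \<circ> refl s \<in> weyl {s, t}" using u by (intro weyl_comp weyl_refl) auto
      have "{s, t} \<subseteq> S" using t less.prems by auto
      then have "u \<circ> refl s \<in> weyl S" "len S (u \<circ> refl s) \<le> len {s, t} (u \<circ> refl s)"
        using us weyl_mono len_mono by blast+
      then have "len S (w \<circ> refl s) \<le> len S v + len {s, t} (u \<circ> refl s)"
        using len_comp_le[OF u(1), of "u \<circ> refl s"] u(3) by (simp add: comp_assoc)
      then show False using c u(4) less.prems by simp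
    qed
    from dihedral_nonneg[OF less.prems(2) t st u(2) this]
    obtain a b where "0 \<le> a" "0 \<le> b" "u (simple s) = lincomb a (simple s) b (simple t)" by blast
    then show ?thesis using pos u by (auto simp: weyl_lincomb nonneg_def)
  qed
qed

text \<open>\<open>root_nonneg\<close> applies to \<open>w\<close> or to
  \<open>w \<circ> refl s\<close>, and these two send \<open>simple s\<close> to opposite
  vectors.\<close>

corollary root_pos_or_neg:
  assumes "w \<in> weyl S" "s \<in> S"
  shows "nonneg (w (simple s)) \<or> nonneg (\<lambda>u. - w (simple s) u)"
proof (cases "len S w \<le> len S (w \<circ> refl s)")
  case True
  then show ?thesis using root_nonneg[OF assms] by simp
next
  case False
  have "w \<circ> refl s \<circ> refl s = w" using assms by (simp add: comp_assoc refl_comp)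
  then have "nonneg ((w \<circ> refl s) (simple s))"
    using root_nonneg[of "w \<circ> refl s" s] False assms weyl_comp weyl_refl by simp
  moreover have "(w \<circ> refl s) (simple s) = (\<lambda>u. - w (simple s) u)"
    using assms weyl_lincomb[OF assms(1), of "-1" "simple s" 0 "simple s"] by (simp add: refl_simple)
  ultimately show ?thesis by simp
qed

section \<open>Roots supported on one or two simple roots\<close>

lemma weyl_form: "w \<in> weyl S \<Longrightarrow> form (w f) (w g) = form f g"
  unfolding weyl_def using form_refls by blast

lemma weyl_inj: "w \<in> weyl S \<Longrightarrow> w f = w g \<Longrightarrow> f = g"
  using refls_inj by (auto simp: weyl_def)

lemma weyl_root_nonzero: "w \<in> weyl S \<Longrightarrow> w (simple x) \<noteq> (\<lambda>u. 0)"
proof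
  assume w: "w \<in> weyl S" "w (simple x) = (\<lambda>u. 0)"
  have "w (\<lambda>u. 0) = (\<lambda>u. 0)" using weyl_lincomb[OF w(1), of 0 "simple x" 0 "simple x"] by simp
  then have "simple x = (\<lambda>u. 0)" using weyl_inj[OF w(1)] w(2) by metis
  then have "simple x x = 0" by metis
  then show False by (simp add: simple_def)
qed

text \<open>Invariance of \<open>form\<close> forces the square of the only nonzero coordinate to be
  1, and positivity excludes -1.\<close>

lemma root_eq_simple:
  assumes "w \<in> weyl S" "x \<in> S" "v \<in> S" "nonneg (w (simple x))" "\<And>u. u \<noteq> v \<Longrightarrow> w (simple x) u = 0"
  shows "w (simple x) = simple v"
proof -
  let ?f = "w (simple x)"
  have f: "?f = lincomb (?f v) (simple v) 0 (simple v)" using assms by (auto simp: simple_def)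
  have "form ?f ?f = -2" using assms by (simp add: weyl_form form_simple pairing_simple)
  moreover from f have "form ?f ?f = form (lincomb (?f v) (simple v) 0 (simple v)) (lincomb (?f v) (simple v) 0 (simple v))"
    by (rule arg_cong2[where f = form, rotated]) (rule f)
  moreover have "form (lincomb (?f v) (simple v) 0 (simple v)) (lincomb (?f v) (simple v) 0 (simple v)) = -2 * (?f v * ?f v)"
    unfolding form_lincomb_left form_simple[OF assms(3)] pairing_lincomb using assms by (simp add: pairing_simple)
  ultimately have "?f v * ?f v = 1" by linarith
  then have "?f v = 1 \<or> ?f v = -1" by (simp add: square_eq_1_iff)
  then have "?f v = 1" using assms(4) unfolding nonneg_def by (metis neg_0_le_iff_le not_one_le_zero)
  then show ?thesis by (subst f) simp
qed

text \<open>All the angles lie in [0, pi], where the cosine is injective; the angle 0 comes from the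
  label 0 alone.\<close>

lemma coef_eq_iff: "coef s t = coef x y \<longleftrightarrow> m s t = m x y"
proof
  assume "coef s t = coef x y"
  then have "cos (pi / m s t) = cos (pi / m x y)" by (simp add: coef_def)
  moreover have "pi / real n \<le> pi" for n
    by (cases "n = 0") (auto simp: field_simps)
  ultimately have "pi / m s t = pi / m x y" using cos_inj_pi by (metis pi_ge_zero divide_nonneg_nonneg of_nat_0_le_iff)
  then show "m s t = m x y" by (cases "m x y = 0"; cases "m s t = 0") (auto simp: field_simps)
qed (simp add: coef_def)

lemma alt_outside: "u \<noteq> s \<Longrightarrow> u \<noteq> t \<Longrightarrow> alt n s t f u = f u"
  by (induction n arbitrary: s t f) (auto simp: refl_other)

lemma alt_inverse:
  assumes "s \<in> S" "t \<in> S"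
  shows "alt n (if even n then t else s) (if even n then s else t) (alt n s t f) = f"
  using assms
proof (induction n arbitrary: s t f)
  case (Suc n)
  have "alt (Suc n) (if even (Suc n) then t else s) (if even (Suc n) then s else t) =
      refl s \<circ> alt n (if even n then s else t) (if even n then t else s)"
    unfolding alt_Suc_end by auto
  then show ?case using Suc.IH[of t s "refl s f"] Suc.prems by (simp add: refl_refl)
qed simp

lemma alt_comp_weyl: "s \<in> S \<Longrightarrow> t \<in> S \<Longrightarrow> w \<in> weyl S \<Longrightarrow> alt n s t \<circ> w \<in> weyl S"
  using alt_weyl[of n s t] weyl_mono[of "{s, t}" S] by (intro weyl_comp) auto

lemma plane_decomp:
  assumes "\<And>u. u \<noteq> s \<Longrightarrow> u \<noteq> t \<Longrightarrow> f u = 0" "s \<noteq> t"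
  shows "f = lincomb (f s) (simple s) (f t) (simple t)"
  using assms by (fastforce simp: simple_def)

text \<open>The preimage p x + q y of \<open>simple s\<close> under \<open>w\<close> is a root, so p
  and q have the same sign, and they are nonnegative because p a + q c = 1 with a, c \<ge> 0. In p b
  + q d = 0 both terms then vanish, which gives b = 0 or d = 0: one of the two positive roots is a
  multiple of \<open>simple s\<close>.\<close>

lemma simple_in_plane:
  assumes w: "w \<in> weyl S" and x: "x \<in> S" "nonneg (w (simple x))" "\<And>u. u \<noteq> s \<Longrightarrow> u \<noteq> t \<Longrightarrow> w (simple x) u = 0"
    and y: "y \<in> S" "nonneg (w (simple y))" "\<And>u. u \<noteq> s \<Longrightarrow> u \<noteq> t \<Longrightarrow> w (simple y) u = 0"
    and xy: "x \<noteq> y" and st: "s \<in> S" "t \<in> S" "s \<noteq> t"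
  shows "simple s = w (simple x) \<or> simple s = w (simple y)"
proof -
  define a b c d where "a = w (simple x) s" and "b = w (simple x) t"
    and "c = w (simple y) s" and "d = w (simple y) t"
  have rx: "w (simple x) = lincomb a (simple s) b (simple t)"
    unfolding a_def b_def using x(3) st(3) by (intro plane_decomp)
  have ry: "w (simple y) = lincomb c (simple s) d (simple t)"
    unfolding c_def d_def using y(3) st(3) by (intro plane_decomp)
  have nn: "0 \<le> a" "0 \<le> b" "0 \<le> c" "0 \<le> d"
    using x(2) y(2) by (auto simp: nonneg_def a_def b_def c_def d_def)
  define D where "D = a * d - b * c"
  have "D \<noteq> 0"
  proof
    assume "D = 0"
    then have "a * d = b * c" by (simp add: D_def)
    then have 1: "w (lincomb c (simple x) (-a) (simple y)) = w (lincomb 0 (simple x) 0 (simple y))"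
      and 2: "w (lincomb d (simple x) (-b) (simple y)) = w (lincomb 0 (simple x) 0 (simple y))"
      unfolding weyl_lincomb[OF w] rx ry by (auto simp: fun_eq_iff algebra_simps simple_def)
    from weyl_inj[OF w 1] weyl_inj[OF w 2] have "a = 0" "b = 0"
      using xy by (auto simp: fun_eq_iff simple_def dest!: spec[of _ y])
    then show False using rx weyl_root_nonzero[OF w, of x] by simp
  qed
  \<comment> \<open>The first row of the inverse of the matrix with columns (a, b) and (c, d), which
    is invertible because \<open>w\<close> is injective.\<close>
  define p q where "p = d / D" and "q = - b / D"
  have pq: "p * a + q * c = 1" "p * b + q * d = 0"
  proof -
    have "p * a + q * c = (a * d - b * c) / D" "p * b + q * d = 0"
      unfolding p_def q_def by (simp_all add: diff_divide_distrib algebra_simps)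
    then show "p * a + q * c = 1" "p * b + q * d = 0" using \<open>D \<noteq> 0\<close> by (simp_all flip: D_def)
  qed
  have s: "simple s = w (lincomb p (simple x) q (simple y))"
  proof
    fix u
    have "w (lincomb p (simple x) q (simple y)) u = (p * a + q * c) * simple s u + (p * b + q * d) * simple t u"
      unfolding weyl_lincomb[OF w] rx ry by (simp add: algebra_simps)
    then show "simple s u = w (lincomb p (simple x) q (simple y)) u" using pq by simp
  qed
  obtain w' where w': "w' \<in> weyl S" "w' \<circ> w = id" using weyl_inverse[OF _ w] by blast
  have "w' (simple s) = lincomb p (simple x) q (simple y)"
    unfolding s using w'(2) by (metis comp_apply id_apply)
  then have "nonneg (lincomb p (simple x) q (simple y)) \<or> nonneg (\<lambda>u. - lincomb p (simple x) q (simple y) u)"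
    using root_pos_or_neg[OF w'(1) st(1)] by simp
  then have "0 \<le> p \<and> 0 \<le> q \<or> p \<le> 0 \<and> q \<le> 0"
    using xy unfolding nonneg_def simple_def by (fastforce dest: spec[of _ x] spec[of _ y])
  moreover have "\<not> (p \<le> 0 \<and> q \<le> 0)"
    using pq(1) nn by (smt (verit) mult_nonpos_nonneg)
  ultimately have pq0: "0 \<le> p" "0 \<le> q" by auto
  then have z: "p * b = 0" "q * d = 0"
    using pq(2) nn by (smt (verit) mult_nonneg_nonneg)+
  have "b = 0 \<or> d = 0" using z pq(1) by auto
  then show ?thesis
  proof
    assume "b = 0"
    then have "w (simple x) u = 0" if "u \<noteq> s" for u using rx that by (simp add: simple_def)
    then show ?thesis using root_eq_simple[OF w x(1) st(1) x(2)] by simp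
  next
    assume "d = 0"
    then have "w (simple y) u = 0" if "u \<noteq> s" for u using ry that by (simp add: simple_def)
    then show ?thesis using root_eq_simple[OF w y(1) st(1) y(2)] by simp
  qed
qed

end

section \<open>Words in an Artin group\<close>

lemma words_append [simp]: "u @ v \<in> words S \<longleftrightarrow> u \<in> words S \<and> v \<in> words S"
  by (auto simp: words_def)

lemma words_Cons [simp]: "x # w \<in> words S \<longleftrightarrow> fst x \<in> S \<and> w \<in> words S"
  by (cases x) (auto simp: words_def)

lemma words_Nil [simp]: "[] \<in> words S"
  by (simp add: words_def)

lemma words_mono: "T \<subseteq> S \<Longrightarrow> w \<in> words T \<Longrightarrow> w \<in> words S"
  by (induction w) auto

lemma alternating_words: "s \<in> S \<Longrightarrow> t \<in> S \<Longrightarrow> alternating_word n s t \<in> words S"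
  by (induction n arbitrary: s t) auto

lemma word_class_eq_iff: "v \<in> words S \<Longrightarrow> word_class S R u = word_class S R v \<longleftrightarrow> word_eq S R u v"
  using word_class_eq word_eq.refl unfolding word_class_def by blast

lemma fold_closed:
  assumes "\<And>a b \<omega>. a \<in> S \<Longrightarrow> \<omega> \<in> \<Omega> \<Longrightarrow> step (a, b) \<omega> \<in> \<Omega>"
  shows "w \<in> words S \<Longrightarrow> \<omega> \<in> \<Omega> \<Longrightarrow> fold step w \<omega> \<in> \<Omega>"
proof (induction w arbitrary: \<omega>)
  case (Cons x w)
  then show ?case using assms[of "fst x" \<omega> "snd x"] by simp
qed simp

text \<open>The universal property of the presentation, for right actions on a set; the action for
  the amalgamated product and the retraction are both instances of it. The set \<Omega> is needed
  since letters need only act invertibly on well-formed states.\<close>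

lemma fold_word_eq:
  assumes closed: "\<And>a b \<omega>. a \<in> S \<Longrightarrow> \<omega> \<in> \<Omega> \<Longrightarrow> step (a, b) \<omega> \<in> \<Omega>"
    and inv: "\<And>a b \<omega>. a \<in> S \<Longrightarrow> \<omega> \<in> \<Omega> \<Longrightarrow> step (a, \<not> b) (step (a, b) \<omega>) = \<omega>"
    and rel: "\<And>u v \<omega>. (u, v) \<in> R \<Longrightarrow> \<omega> \<in> \<Omega> \<Longrightarrow> fold step u \<omega> = fold step v \<omega>"
  shows "word_eq S R u v \<Longrightarrow> \<omega> \<in> \<Omega> \<Longrightarrow> fold step u \<omega> = fold step v \<omega>"
proof (induction arbitrary: \<omega> rule: word_eq.induct)
  case (append u v u' v')
  have "fold step v \<omega> \<in> \<Omega>"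
    using fold_closed[where step = step, OF closed] word_eq_words[OF append.hyps(1)] append.prems by blast
  then show ?case using append by simp
qed (simp_all add: inv rel)

lemma alternating_word_add:
  "alternating_word (n + k) s t = alternating_word n s t @ (if even n then alternating_word k s t else alternating_word k t s)"
  by (induction n arbitrary: s t) auto

lemma alternating_word_Suc_end:
  "alternating_word (Suc n) s t = alternating_word n s t @ [(if even n then s else t, True)]"
  using alternating_word_add[of n 1 s t] by simp

locale artin =
  fixes \<Gamma> :: "'v sgraph" and \<mu> :: "'v set \<Rightarrow> nat"
  assumes graph: "finite_simple_graph \<Gamma>"
    and label_ge_2: "e \<in> edges \<Gamma> \<Longrightarrow> 2 \<le> \<mu> e"
begin

abbreviation V where "V \<equiv> verts \<Gamma>"
abbreviation G where "G \<equiv> artin_group \<Gamma> \<mu>"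
abbreviation cls where "cls \<equiv> word_class V (artin_relations \<Gamma> \<mu>)"

definition parabolic :: "'v set \<Rightarrow> 'v word set set" where
  "parabolic U = cls ` words U"

sublocale G: group G
  unfolding artin_group_def by (rule group_presented_group)

lemma carrier_G: "carrier G = parabolic V"
  by (simp add: artin_group_def presented_group_def parabolic_def)

lemma cls_closed: "w \<in> words V \<Longrightarrow> cls w \<in> carrier G"
  by (simp add: carrier_G parabolic_def)

lemma cls_mult: "u \<in> words V \<Longrightarrow> v \<in> words V \<Longrightarrow> cls u \<otimes>\<^bsub>G\<^esub> cls v = cls (u @ v)"
  unfolding artin_group_def by (rule presented_group_mult)

lemma cls_Nil: "cls [] = \<one>\<^bsub>G\<^esub>"
  by (simp add: artin_group_def presented_group_def)

lemma cls_cancel: "v \<in> V \<Longrightarrow> cls [(v, b)] \<otimes>\<^bsub>G\<^esub> cls [(v, \<not> b)] = \<one>\<^bsub>G\<^esub>"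
  by (simp add: cls_mult flip: cls_Nil) (intro word_class_eq word_eq.cancel)

lemma mult_cls_cancel:
  "v \<in> V \<Longrightarrow> h \<in> carrier G \<Longrightarrow> h \<otimes>\<^bsub>G\<^esub> cls [(v, b)] \<otimes>\<^bsub>G\<^esub> cls [(v, \<not> b)] = h"
  by (simp add: G.m_assoc cls_closed cls_cancel)

lemma edge_distinct: "{s, t} \<in> edges \<Gamma> \<Longrightarrow> s \<in> V \<and> t \<in> V \<and> s \<noteq> t"
  using graph unfolding finite_simple_graph_def by fastforce

lemma cls_braid:
  assumes "{s, t} \<in> edges \<Gamma>"
  shows "cls (alternating_word (\<mu> {s, t}) s t) = cls (alternating_word (\<mu> {s, t}) t s)"
  using assms edge_distinct[OF assms]
  by (intro word_class_eq word_eq.relation alternating_words) (auto simp: artin_relations_def)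

lemma parabolic_mono: "U \<subseteq> W \<Longrightarrow> parabolic U \<subseteq> parabolic W"
  using words_mono unfolding parabolic_def by blast

lemma parabolic_mult:
  assumes "U \<subseteq> V" "g \<in> parabolic U" "h \<in> parabolic U"
  shows "g \<otimes>\<^bsub>G\<^esub> h \<in> parabolic U"
proof -
  obtain u v where "u \<in> words U" "v \<in> words U" "g = cls u" "h = cls v"
    using assms by (auto simp: parabolic_def)
  then show ?thesis
    using assms words_mono[of U V] by (auto simp: parabolic_def cls_mult intro!: imageI)
qed

lemma subgroup_parabolic:
  assumes "U \<subseteq> V"
  shows "subgroup (parabolic U) G"
proof (rule G.subgroupI)
  show "parabolic U \<subseteq> carrier G" using parabolic_mono[OF assms] by (simp add: carrier_G)
  show "parabolic U \<noteq> {}" by (auto simp: parabolic_def intro: words_Nil)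
  show "g \<otimes>\<^bsub>G\<^esub> h \<in> parabolic U" if "g \<in> parabolic U" "h \<in> parabolic U" for g h
    using that assms by (intro parabolic_mult)
  fix g assume "g \<in> parabolic U"
  then obtain w where w: "w \<in> words U" "g = cls w" by (auto simp: parabolic_def)
  let ?i = "rev (map (apsnd Not) w)"
  have i: "?i \<in> words U" using w by (intro inverse_words)
  have "cls ?i \<otimes>\<^bsub>G\<^esub> g = \<one>\<^bsub>G\<^esub>"
    using w i words_mono[OF assms] word_inverse[of w V "artin_relations \<Gamma> \<mu>"]
    by (simp add: cls_mult word_class_eq flip: cls_Nil)
  then have "inv\<^bsub>G\<^esub> g = cls ?i"
    using w i words_mono[OF assms] by (intro G.inv_equality) (auto intro: cls_closed)
  then show "inv\<^bsub>G\<^esub> g \<in> parabolic U" using i by (auto simp: parabolic_def)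
qed

end

section \<open>The amalgamated product of a non-adjacent pair\<close>

text \<open>Left multiplication by the generator \<open>x\<close> in a free product of groups of
  order 2, whose reduced words are the lists without equal neighbours.\<close>

fun toggle :: "'b \<Rightarrow> 'b list \<Rightarrow> 'b list" where
  "toggle x [] = [x]"
| "toggle x (y # ys) = (if x = y then ys else x # y # ys)"

lemma distinct_adj_toggle: "distinct_adj ys \<Longrightarrow> distinct_adj (toggle x ys)"
  by (cases ys) (auto simp: distinct_adj_Cons)

lemma toggle_toggle: "distinct_adj ys \<Longrightarrow> toggle x (toggle x ys) = ys"
proof (cases ys)
  case (Cons y zs)
  assume "distinct_adj ys"
  then show ?thesis using Cons by (cases zs) auto
qed simp

lemma toggle_fresh: "ys = [] \<or> hd ys \<noteq> x \<Longrightarrow> toggle x ys = x # ys"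
  by (cases ys) auto

locale artin_nonedge = artin \<Gamma> \<mu>
  for \<Gamma> :: "'v sgraph" and \<mu> :: "'v set \<Rightarrow> nat" +
  fixes s t :: 'v
  assumes st: "s \<in> V" "t \<in> V" "s \<noteq> t" "{s, t} \<notin> edges \<Gamma>"
begin

abbreviation "C \<equiv> parabolic (V - {s, t})"

text \<open>The group acts from the right on pairs of an element and a word, without equal adjacent letters,
  in the free product of groups of order 2 indexed by the cosets of \<open>C\<close>. The factor \<open>V - {s}\<close> leaves
  the word unchanged, and \<open>g\<close> in the factor \<open>V - {t}\<close> multiplies it by the letters \<open>hC\<close> and \<open>hgC\<close>;
  the two prescriptions agree on \<open>C\<close>. No letters cancel along a reduced product, so the action
  detects the factor in which it starts.\<close>

definition coset :: "'v word set \<Rightarrow> 'v word set set" where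
  "coset h = (\<lambda>c. h \<otimes>\<^bsub>G\<^esub> c) ` C"

text \<open>Only the letter \<open>s\<close> touches the list: \<open>t\<close> lies in the factor
  that leaves it alone, and any other letter lies in \<open>C\<close>, so that it preserves the
  coset and its two toggles would cancel.\<close>

definition step :: "'v \<times> bool \<Rightarrow> 'v word set \<times> 'v word set set list \<Rightarrow> 'v word set \<times> 'v word set set list" where
  "step x \<omega> = (let h = fst \<omega>; h' = h \<otimes>\<^bsub>G\<^esub> cls [x] in
     (h', if fst x = s then toggle (coset h') (toggle (coset h) (snd \<omega>)) else snd \<omega>))"

abbreviation "states \<equiv> carrier G \<times> {l. distinct_adj l}"

lemma C_subgroup: "subgroup C G"
  by (intro subgroup_parabolic) auto

lemma coset_mult:
  assumes "h \<in> carrier G" "g \<in> C"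
  shows "coset (h \<otimes>\<^bsub>G\<^esub> g) = coset h"
proof
  interpret C: subgroup C G by (rule C_subgroup)
  show "coset (h \<otimes>\<^bsub>G\<^esub> g) \<subseteq> coset h"
    using assms by (auto simp: coset_def G.m_assoc)
  show "coset h \<subseteq> coset (h \<otimes>\<^bsub>G\<^esub> g)"
  proof
    fix x assume "x \<in> coset h"
    then obtain c where c: "c \<in> C" "x = h \<otimes>\<^bsub>G\<^esub> c" by (auto simp: coset_def)
    then have "x = h \<otimes>\<^bsub>G\<^esub> g \<otimes>\<^bsub>G\<^esub> (inv\<^bsub>G\<^esub> g \<otimes>\<^bsub>G\<^esub> c)"
      using assms by (simp add: G.m_assoc[symmetric]) (simp add: G.m_assoc)
    then show "x \<in> coset (h \<otimes>\<^bsub>G\<^esub> g)" using c assms by (auto simp: coset_def)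
  qed
qed

lemma coset_eqD:
  assumes "h \<in> carrier G" "g \<in> carrier G" "coset (h \<otimes>\<^bsub>G\<^esub> g) = coset h"
  shows "g \<in> C"
proof -
  interpret C: subgroup C G by (rule C_subgroup)
  have "h \<otimes>\<^bsub>G\<^esub> g \<otimes>\<^bsub>G\<^esub> \<one>\<^bsub>G\<^esub> \<in> coset h"
    using assms(3) C.one_closed unfolding coset_def by blast
  then obtain c where "c \<in> C" "h \<otimes>\<^bsub>G\<^esub> g = h \<otimes>\<^bsub>G\<^esub> c"
    using assms by (auto simp: coset_def)
  then show ?thesis using assms by simp
qed

lemma step_closed: "a \<in> V \<Longrightarrow> \<omega> \<in> states \<Longrightarrow> step (a, b) \<omega> \<in> states"
  by (cases \<omega>) (simp add: step_def Let_def cls_closed distinct_adj_toggle)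

lemma step_inverse: "a \<in> V \<Longrightarrow> \<omega> \<in> states \<Longrightarrow> step (a, \<not> b) (step (a, b) \<omega>) = \<omega>"
  by (cases \<omega>) (auto simp: step_def Let_def mult_cls_cancel distinct_adj_toggle toggle_toggle)

lemma fold_step_left:
  assumes "w \<in> words (V - {s})" "h \<in> carrier G"
  shows "fold step w (h, l) = (h \<otimes>\<^bsub>G\<^esub> cls w, l)"
  using assms
proof (induction w arbitrary: h)
  case (Cons x w)
  then have "[x] \<in> words V" "w \<in> words V" "fst x \<noteq> s" using words_mono[of "V - {s}" V w] by auto
  then show ?case
    using Cons by (simp add: step_def Let_def cls_closed G.m_assoc cls_mult)
qed (simp add: cls_Nil)

text \<open>The product telescopes: the coset toggled at the end of one letter is toggled again at
  the start of the next.\<close>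

lemma fold_step_right:
  assumes "w \<in> words (V - {t})" "h \<in> carrier G" "distinct_adj l"
  shows "fold step w (h, l) = (h \<otimes>\<^bsub>G\<^esub> cls w, toggle (coset (h \<otimes>\<^bsub>G\<^esub> cls w)) (toggle (coset h) l))"
  using assms
proof (induction w arbitrary: h l)
  case (Cons x w)
  let ?h = "h \<otimes>\<^bsub>G\<^esub> cls [x]"
  have x: "[x] \<in> words V" "w \<in> words V" using Cons.prems words_mono[of "V - {t}" V w] by auto
  then have h: "?h \<in> carrier G" "?h \<otimes>\<^bsub>G\<^esub> cls w = h \<otimes>\<^bsub>G\<^esub> cls (x # w)"
    using Cons.prems by (simp_all add: cls_closed G.m_assoc cls_mult)
  show ?case
  proof (cases "fst x = s")
    case True
    then show ?thesis using Cons h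
      by (simp add: step_def Let_def distinct_adj_toggle toggle_toggle)
  next
    case False
    then have "cls [x] \<in> C" using Cons.prems unfolding parabolic_def by (intro imageI) simp
    then have "coset ?h = coset h" using Cons.prems by (intro coset_mult)
    then show ?thesis using Cons h False by (simp add: step_def Let_def)
  qed
qed (simp add: cls_Nil toggle_toggle)

text \<open>Over a word in one of the two factors the action depends on the word only through its
  class in the group, and the two sides of a relation have the same class.\<close>

lemma step_relation:
  assumes "(u, v) \<in> artin_relations \<Gamma> \<mu>" "\<omega> \<in> states"
  shows "fold step u \<omega> = fold step v \<omega>"
proof -
  obtain x y where xy: "{x, y} \<in> edges \<Gamma>"
      "u = alternating_word (\<mu> {x, y}) x y" "v = alternating_word (\<mu> {x, y}) y x"
    using assms by (auto simp: artin_relations_def)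
  have c: "cls u = cls v" using xy cls_braid by simp
  have V: "x \<in> V" "y \<in> V" "x \<noteq> y" using edge_distinct[OF xy(1)] by auto
  obtain h l where hl: "\<omega> = (h, l)" "h \<in> carrier G" "distinct_adj l" using assms by auto
  show ?thesis
  proof (cases "s \<in> {x, y}")
    case True
    then have "t \<notin> {x, y}" using xy V st by (auto simp: insert_commute)
    then have "u \<in> words (V - {t})" "v \<in> words (V - {t})"
      using V by (auto simp: xy intro!: alternating_words)
    then show ?thesis using hl c by (simp add: fold_step_right)
  next
    case False
    then have "u \<in> words (V - {s})" "v \<in> words (V - {s})"
      using V by (auto simp: xy intro!: alternating_words)
    then show ?thesis using hl c by (simp add: fold_step_left)
  qed
qed

lemma fold_step_cls:
  assumes "v \<in> words V" "cls u = cls v" "\<omega> \<in> states"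
  shows "fold step u \<omega> = fold step v \<omega>"
  using fold_word_eq[of V states step, OF step_closed step_inverse step_relation] assms
  by (simp add: word_class_eq_iff)

text \<open>\<open>True\<close> is the factor generated by \<open>V - {s}\<close>, and \<open>False\<close> the one generated by \<open>V - {t}\<close>.\<close>

fun reduced :: "bool \<Rightarrow> 'v word list \<Rightarrow> bool" where
  "reduced b [] \<longleftrightarrow> True"
| "reduced b (w # ws) \<longleftrightarrow> w \<in> words (V - {if b then s else t}) \<and> cls w \<notin> C \<and> reduced (\<not> b) ws"

lemma reduced_append:
  "reduced b (us @ ws) \<longleftrightarrow> reduced b us \<and> reduced (if even (length us) then b else \<not> b) ws"
  by (induction us arbitrary: b) auto

lemma reduced_words: "reduced b ws \<Longrightarrow> concat ws \<in> words V"
  by (induction ws arbitrary: b) (auto intro: words_mono[rotated])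

lemma C_mult_iff:
  assumes "u \<in> words V" "w \<in> words V"
  shows "cls u \<in> C \<Longrightarrow> cls (u @ w) \<in> C \<longleftrightarrow> cls w \<in> C"
    "cls w \<in> C \<Longrightarrow> cls (u @ w) \<in> C \<longleftrightarrow> cls u \<in> C"
proof -
  interpret C: subgroup C G by (rule C_subgroup)
  have c: "cls u \<in> carrier G" "cls w \<in> carrier G" using assms by (auto intro: cls_closed)
  have m: "cls (u @ w) = cls u \<otimes>\<^bsub>G\<^esub> cls w" using assms by (simp add: cls_mult)
  have "cls w = inv\<^bsub>G\<^esub> cls u \<otimes>\<^bsub>G\<^esub> (cls u \<otimes>\<^bsub>G\<^esub> cls w)"
    using c by (simp add: G.m_assoc[symmetric])
  then show "cls u \<in> C \<Longrightarrow> cls (u @ w) \<in> C \<longleftrightarrow> cls w \<in> C"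
    unfolding m by (metis C.m_closed C.m_inv_closed)
  have "cls u = (cls u \<otimes>\<^bsub>G\<^esub> cls w) \<otimes>\<^bsub>G\<^esub> inv\<^bsub>G\<^esub> cls w"
    using c by (simp add: G.m_assoc)
  then show "cls w \<in> C \<Longrightarrow> cls (u @ w) \<in> C \<longleftrightarrow> cls u \<in> C"
    unfolding m by (metis C.m_closed C.m_inv_closed)
qed

lemma C_word:
  assumes "cls w \<in> C"
  obtains c where "c \<in> words (V - {s, t})" "cls w = cls c"
  using assms by (auto simp: parabolic_def)

lemma cls_append_cong:
  "u \<in> words V \<Longrightarrow> u' \<in> words V \<Longrightarrow> w \<in> words V \<Longrightarrow> w' \<in> words V \<Longrightarrow> cls u = cls u' \<Longrightarrow> cls w = cls w' \<Longrightarrow> cls (u @ w) = cls (u' @ w')"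
  by (simp flip: cls_mult)

lemma C_words: "w \<in> words (V - {s, t}) \<Longrightarrow> w \<in> words (V - {if b then s else t})"
  by (rule words_mono[of "V - {s, t}"]) auto

lemma factor_words: "w \<in> words (V - {if b then s else t}) \<Longrightarrow> w \<in> words V"
  by (rule words_mono[of "V - {if b then s else t}"]) auto

lemma reduced_exists:
  assumes "w \<in> words V"
  shows "cls w \<in> C \<or> (\<exists>b ws. ws \<noteq> [] \<and> reduced b ws \<and> cls w = cls (concat ws))"
  using assms
proof (induction w)
  case Nil
  then show ?case unfolding parabolic_def by auto
next
  case (Cons x w)
  then have x: "[x] \<in> words V" "w \<in> words V" by auto
  define b where "b = (fst x \<noteq> s)"
  have xb: "[x] \<in> words (V - {if b then s else t})" using x st by (auto simp: b_def)
  from Cons.IH[OF x(2)] show ?case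
  proof (elim disjE exE conjE)
    assume "cls w \<in> C"
    then obtain c where c: "c \<in> words (V - {s, t})" "cls w = cls c" by (rule C_word)
    have e: "cls (x # w) = cls ([x] @ c)"
      using cls_append_cong[of "[x]" "[x]" w c] x c factor_words[OF C_words[OF c(1)]] by simp
    show ?thesis
    proof (cases "cls ([x] @ c) \<in> C")
      case True
      then show ?thesis unfolding e by blast
    next
      case False
      then have "reduced b [[x] @ c]" using xb C_words[OF c(1), of b] by (simp del: append.simps)
      then show ?thesis unfolding e by (intro disjI2 exI[of _ b] exI[of _ "[[x] @ c]"]) simp
    qed
  next
    fix b' ws assume ws: "ws \<noteq> []" "reduced b' ws" "cls w = cls (concat ws)"
    have cx: "cls (x # w) = cls ([x] @ concat ws)"
      using cls_append_cong[of "[x]" "[x]" w "concat ws"] x ws reduced_words by simp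
    show ?thesis
    \<comment> \<open>The test concerns the class of the letter. Its failure gives both conditions
      for a new syllable: the letter belongs to the other factor, and it is not in
      \<open>C\<close>.\<close>
    proof (cases "\<exists>x'\<in>words (V - {if b' then s else t}). cls x' = cls [x]")
      case True
      then obtain x' where x': "x' \<in> words (V - {if b' then s else t})" "cls x' = cls [x]" by blast
      obtain w1 us where w1: "ws = w1 # us" using ws by (cases ws) auto
      have r: "w1 \<in> words (V - {if b' then s else t})" "cls w1 \<notin> C" "reduced (\<not> b') us"
        using ws w1 by auto
      have V: "x' \<in> words V" "w1 \<in> words V" "concat us \<in> words V"
        using factor_words x' r reduced_words by blast+
      have cx': "cls (x # w) = cls ((x' @ w1) @ concat us)"
        unfolding cx using cls_append_cong[of x' "[x]" "concat ws" "concat ws"] x' V x w1 by simp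
      show ?thesis
      proof (cases "cls (x' @ w1) \<in> C")
        case False
        then have "reduced b' ((x' @ w1) # us)" using r x' by simp
        then show ?thesis unfolding cx' by (intro disjI2 exI[of _ b'] exI[of _ "(x' @ w1) # us"]) simp
      next
        case True
        \<comment> \<open>A first syllable that has fallen into \<open>C\<close> is absorbed by the
          next one, which stays outside \<open>C\<close>; if there is none, the whole element lies
          in \<open>C\<close>.\<close>
        then obtain c where c: "c \<in> words (V - {s, t})" "cls (x' @ w1) = cls c" by (rule C_word)
        have cV: "c \<in> words V" using c C_words factor_words by blast
        have cx'': "cls (x # w) = cls (c @ concat us)"
          unfolding cx' using V c cV by (intro cls_append_cong) auto
        show ?thesis
        proof (cases us)
          case Nil
          then show ?thesis using cx'' c True by simp
        next
          case (Cons w2 vs)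
          then have "cls (c @ w2) \<notin> C"
            using C_mult_iff(1)[of c w2] c True cV r factor_words[of w2 "\<not> b'"] by simp
          then have "reduced (\<not> b') ((c @ w2) # vs)"
            using r Cons C_words[OF c(1), of "\<not> b'"] by simp
          then show ?thesis unfolding cx''
            by (intro disjI2 exI[of _ "\<not> b'"] exI[of _ "(c @ w2) # vs"]) (simp add: Cons)
        qed
      qed
    next
      case False
      then have bb: "b = (\<not> b')" using xb by (cases b; cases b') auto
      have "cls [x] \<notin> C"
      proof
        assume "cls [x] \<in> C"
        then obtain c where "c \<in> words (V - {s, t})" "cls [x] = cls c" by (rule C_word)
        then show False using False C_words by metis
      qed
      then have "reduced b ([x] # ws)" using xb ws bb by simp
      then show ?thesis unfolding cx by (intro disjI2 exI[of _ b] exI[of _ "[x] # ws"]) simp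
    qed
  qed
qed

text \<open>The condition on \<open>hd l\<close> makes every toggle a fresh letter. A syllable with
  \<open>b\<close> true leaves the list alone but moves away from the coset at its head; one with
  \<open>b\<close> false then pushes the old coset and the new one, which are distinct.\<close>

lemma reduced_walk:
  assumes "reduced b ws" "h \<in> carrier G" "distinct_adj l" "l = [] \<or> (hd l = coset h \<longleftrightarrow> b)"
  shows "\<exists>l'. snd (fold step (concat ws) (h, l)) = l' @ l"
  using assms
proof (induction ws arbitrary: b h l)
  case (Cons w ws)
  let ?h = "h \<otimes>\<^bsub>G\<^esub> cls w"
  have w: "w \<in> words V" using Cons.prems factor_words[of w b] by simp
  then have h: "?h \<in> carrier G" using Cons.prems cls_closed by simp
  have ne: "coset ?h \<noteq> coset h" using coset_eqD[of h "cls w"] Cons.prems w cls_closed by auto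
  show ?case
  proof (cases b)
    case True
    have "l = [] \<or> (hd l = coset ?h \<longleftrightarrow> \<not> b)" using ne Cons.prems True by auto
    then show ?thesis
      using Cons.IH[of "\<not> b" ?h l] Cons.prems h True by (simp add: fold_step_left)
  next
    case False
    let ?l = "coset ?h # coset h # l"
    have "toggle (coset h) l = coset h # l" using Cons.prems False by (intro toggle_fresh) auto
    then have "fold step w (h, l) = (?h, ?l)"
      using Cons.prems False ne by (simp add: fold_step_right)
    moreover have "distinct_adj ?l" using Cons.prems ne False by (cases l) auto
    then have "\<exists>l'. snd (fold step (concat ws) (?h, ?l)) = l' @ ?l"
      using Cons.IH[of "\<not> b" ?h ?l] Cons.prems h False by simp
    ultimately show ?thesis by force
  qed
qed simp

text \<open>The last entry of the list reveals the start. It is the coset of the identity if the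
  first syllable lies in the factor of \<open>V - {t}\<close>, and otherwise the coset of the first
  syllable \<open>u\<close>, which is not in \<open>C\<close>. Length two ensures that an expression
  of the second kind pushes an entry at all.\<close>

lemma reduced_first_factor:
  assumes "reduced True us" "reduced False ws" "2 \<le> length us" "ws \<noteq> []"
  shows "cls (concat us) \<noteq> cls (concat ws)"
proof
  assume e: "cls (concat us) = cls (concat ws)"
  have e': "fold step (concat us) (\<one>\<^bsub>G\<^esub>, []) = fold step (concat ws) (\<one>\<^bsub>G\<^esub>, [])"
    using fold_step_cls[OF reduced_words[OF assms(2)] e] by simp
  obtain w ws' where ws: "ws = w # ws'" using assms by (cases ws) auto
  have w: "w \<in> words (V - {t})" "cls w \<notin> C" "reduced True ws'" "cls w \<in> carrier G"
    using assms ws factor_words[of w False] cls_closed by auto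
  let ?c = "coset (cls w)" and ?d = "coset \<one>\<^bsub>G\<^esub>"
  have ne: "coset (cls v) \<noteq> ?d" if "v \<in> words V" "cls v \<notin> C" for v
    using coset_eqD[of "\<one>\<^bsub>G\<^esub>" "cls v"] that cls_closed by auto
  have "fold step w (\<one>\<^bsub>G\<^esub>, []) = (cls w, [?c, ?d])"
    using w ne[of w] factor_words[of w False] by (simp add: fold_step_right)
  then obtain l1 where l1: "snd (fold step (concat ws) (\<one>\<^bsub>G\<^esub>, [])) = l1 @ [?c, ?d]"
    using reduced_walk[OF w(3,4), of "[?c, ?d]"] ne[of w] w factor_words[of w False] by (auto simp: ws)
  obtain u v us' where us: "us = u # v # us'" using assms(3) by (cases us; cases "tl us") auto
  have u: "u \<in> words (V - {s})" "cls u \<notin> C" "cls u \<in> carrier G"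
    and v: "v \<in> words (V - {t})" "cls v \<notin> C" "cls v \<in> carrier G" and r: "reduced True us'"
    using assms us factor_words[of u True] factor_words[of v False] cls_closed by auto
  let ?h = "cls u \<otimes>\<^bsub>G\<^esub> cls v"
  have ne2: "coset ?h \<noteq> coset (cls u)" using coset_eqD u v by blast
  have "fold step (u @ v) (\<one>\<^bsub>G\<^esub>, []) = (?h, [coset ?h, coset (cls u)])"
    using u v ne2 by (simp add: fold_step_right fold_step_left)
  then obtain l2 where l2: "snd (fold step (concat us) (\<one>\<^bsub>G\<^esub>, [])) = l2 @ [coset ?h, coset (cls u)]"
    using reduced_walk[OF r, of ?h "[coset ?h, coset (cls u)]"] ne2 u v by (auto simp: us)
  have "coset (cls u) = ?d" using l1 l2 e' by simp
  then show False using ne[of u] u factor_words[of u True] by simp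
qed

text \<open>Conjugation by the first syllable rotates a reduced expression of a central element. If the
  number of syllables is even, this changes the factor containing the first syllable; otherwise it
  makes the expression shorter.\<close>

theorem central_in_factor:
  assumes "z \<in> center G"
  shows "z \<in> parabolic (V - {s}) \<or> z \<in> parabolic (V - {t})"
proof -
  have *: "cls (concat ws) \<in> parabolic (V - {s}) \<or> cls (concat ws) \<in> parabolic (V - {t})"
    if "reduced b ws" "cls (concat ws) = z" "ws \<noteq> []" for b ws
    using that
  proof (induction "length ws" arbitrary: ws b rule: less_induct)
    case less
    obtain w us where ws: "ws = w # us" using less.prems by (cases ws) auto
    have w: "w \<in> words V" "cls w \<notin> C" "w \<in> words (V - {if b then s else t})"
      and us: "reduced (\<not> b) us" "concat us \<in> words V"
      using less.prems ws factor_words reduced_words by auto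
    show ?case
    proof (cases "us = []")
      case True
      then show ?thesis using w ws by (cases b) (auto simp: parabolic_def)
    next
      case False
      have "cls w \<otimes>\<^bsub>G\<^esub> cls (concat us @ w) = z \<otimes>\<^bsub>G\<^esub> cls w"
        using w us less.prems ws by (simp add: cls_mult flip: less.prems(2))
      also have "\<dots> = cls w \<otimes>\<^bsub>G\<^esub> z"
        using assms w cls_closed by (simp add: center_def)
      finally have rot: "cls (concat us @ w) = z"
        using w us assms cls_closed by (simp add: center_def)
      show ?thesis
      proof (cases "even (length ws)")
        case True
        have "reduced (\<not> b) (us @ [w])" using us w True ws by (simp add: reduced_append)
        moreover have "2 \<le> length ws" "2 \<le> length (us @ [w])" using False ws by (cases us; simp)+
        moreover have "cls (concat (us @ [w])) = cls (concat ws)" using rot less.prems by simp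
        ultimately show ?thesis
          using reduced_first_factor[of ws "us @ [w]"] reduced_first_factor[of "us @ [w]" ws] less.prems
          by (cases b) auto
      next
        case odd: False
        obtain vs y where vs: "us = vs @ [y]" using False by (cases us rule: rev_cases) auto
        have len: "even (length us)" "odd (length vs)" "vs \<noteq> []" using odd ws vs by auto
        have y: "reduced (\<not> b) vs" "y \<in> words (V - {if b then s else t})" "y \<in> words V" "concat vs \<in> words V"
          using us vs len factor_words by (auto simp: reduced_append)
        \<comment> \<open>For an odd number of syllables \<open>y\<close> and \<open>w\<close> lie
          in the same factor and merge into one syllable. If that falls into \<open>C\<close>, the
          preceding syllable \<open>x\<close> absorbs it.\<close>
        have yw: "cls (concat vs @ (y @ w)) = z" using rot vs by simp
        show ?thesis
        proof (cases "cls (y @ w) \<in> C")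
          case False
          then have "reduced (\<not> b) (vs @ [y @ w])" using y w len by (simp add: reduced_append)
          then show ?thesis
            using less.hyps[of "vs @ [y @ w]" "\<not> b"] yw ws vs less.prems by simp
        next
          case True
          then obtain c where c: "c \<in> words (V - {s, t})" "cls (y @ w) = cls c" by (rule C_word)
          have cV: "c \<in> words V" using c C_words factor_words by blast
          obtain xs x where xs: "vs = xs @ [x]" using len by (cases vs rule: rev_cases) auto
          have ev: "even (length xs)" using len xs by simp
          have x: "reduced (\<not> b) xs" "x \<in> words (V - {if \<not> b then s else t})" "cls x \<notin> C"
            using y xs ev by (auto simp: reduced_append)
          have "cls (x @ c) \<notin> C" using C_mult_iff(2)[of x c] x cV c True factor_words by auto
          then have "reduced (\<not> b) (xs @ [x @ c])"
            using x ev C_words[OF c(1), of "\<not> b"] by (simp add: reduced_append)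
          moreover have "cls (concat (xs @ [x @ c])) = z"
            using cls_append_cong[of "concat vs" "concat vs" c "y @ w"] y w cV c yw xs by simp
          ultimately show ?thesis
            using less.hyps[of "xs @ [x @ c]" "\<not> b"] ws vs xs less.prems by simp
        qed
      qed
    qed
  qed
  have "z \<in> carrier G" using assms by (simp add: center_def)
  then obtain w where w: "w \<in> words V" "z = cls w" by (auto simp: carrier_G parabolic_def)
  show ?thesis
  proof (cases "cls w \<in> C")
    case True
    then show ?thesis using w parabolic_mono[of "V - {s, t}" "V - {s}"] by auto
  next
    case False
    then show ?thesis using reduced_exists[OF w(1)] w * by metis
  qed
qed

end

section \<open>The retraction onto a standard parabolic subgroup\<close>

definition coxeter_label :: "'v sgraph \<Rightarrow> ('v set \<Rightarrow> nat) \<Rightarrow> 'v \<Rightarrow> 'v \<Rightarrow> nat" where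
  "coxeter_label \<Gamma> \<mu> s t = (if s = t then 1 else if {s, t} \<in> edges \<Gamma> then \<mu> {s, t} else 0)"

sublocale artin \<subseteq> coxeter_matrix V "coxeter_label \<Gamma> \<mu>"
proof
  show "finite V" using graph by (simp add: finite_simple_graph_def)
  show "coxeter_label \<Gamma> \<mu> s t \<noteq> 1" if "s \<noteq> t" for s t
    using that label_ge_2[of "{s, t}"] by (auto simp: coxeter_label_def)
qed (auto simp: coxeter_label_def insert_commute)

locale artin_retraction = artin \<Gamma> \<mu>
  for \<Gamma> :: "'v sgraph" and \<mu> :: "'v set \<Rightarrow> nat" +
  fixes T :: "'v set"
  assumes T: "T \<subseteq> V"
begin

text \<open>A chamber \<open>w\<close> is the inverse of the minimal representative of a right coset of the standard
  parabolic subgroup of \<open>T\<close> in the Coxeter group. A generator either moves the coset or fixes it,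
  and in the latter case it is conjugate by \<open>w\<close> to an element of \<open>T\<close>, which multiplies the first
  component of the state.\<close>

definition chambers :: "(('v \<Rightarrow> real) \<Rightarrow> 'v \<Rightarrow> real) set" where
  "chambers = {w \<in> weyl V. \<forall>x\<in>T. nonneg (w (simple x))}"

definition step where
  "step l \<omega> = (case l of (v, b) \<Rightarrow> case \<omega> of (a, w) \<Rightarrow>
     if \<exists>x\<in>T. w (simple x) = simple v
     then (a \<otimes>\<^bsub>G\<^esub> cls [(THE x. x \<in> T \<and> w (simple x) = simple v, b)], w)
     else (a, refl v \<circ> w))"

abbreviation "states \<equiv> carrier G \<times> chambers"

lemma step_fix:
  assumes "w \<in> weyl V" "x \<in> T" "w (simple x) = simple v"
  shows "step (v, b) (a, w) = (a \<otimes>\<^bsub>G\<^esub> cls [(x, b)], w)"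
proof -
  have "(THE x. x \<in> T \<and> w (simple x) = simple v) = x"
    using assms weyl_inj[OF assms(1)] by (intro the_equality) (auto simp flip: assms(3) dest: weyl_inj)
  then show ?thesis using assms by (auto simp: step_def)
qed

lemma step_move:
  assumes "\<And>x. x \<in> T \<Longrightarrow> w (simple x) \<noteq> simple v"
  shows "step (v, b) (a, w) = (a, refl v \<circ> w)"
  using assms by (auto simp: step_def)

text \<open>\<open>refl v\<close> alters only the coordinate at \<open>v\<close>, so a positive root
  that it makes negative is supported on \<open>v\<close> and therefore equals
  \<open>simple v\<close>, which is excluded.\<close>

lemma chamber_move:
  assumes w: "w \<in> chambers" and v: "v \<in> V" and "\<And>x. x \<in> T \<Longrightarrow> w (simple x) \<noteq> simple v"
  shows "refl v \<circ> w \<in> chambers"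
proof -
  have "refl v \<circ> w \<in> weyl V" using w v by (intro weyl_comp weyl_refl) (auto simp: chambers_def)
  moreover have "nonneg (refl v (w (simple x)))" if x: "x \<in> T" for x
  proof (rule ccontr)
    assume "\<not> ?thesis"
    then have "nonneg (\<lambda>u. - refl v (w (simple x)) u)"
      using root_pos_or_neg[OF \<open>refl v \<circ> w \<in> weyl V\<close>, of x] x T by auto
    then have "w (simple x) u \<le> 0" if "u \<noteq> v" for u
      using that unfolding nonneg_def by (metis neg_0_le_iff_le refl_other)
    moreover have nn: "nonneg (w (simple x))" using w x by (simp add: chambers_def)
    ultimately have "w (simple x) u = 0" if "u \<noteq> v" for u
      using that by (meson nonneg_def order_antisym)
    then have "w (simple x) = simple v"
      using root_eq_simple[of w x v] w x T v nn by (auto simp: chambers_def)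
    then show False using assms(3) x by blast
  qed
  ultimately show ?thesis by (simp add: chambers_def)
qed

lemma step_closed:
  assumes "v \<in> V" "\<omega> \<in> states"
  shows "step (v, b) \<omega> \<in> states"
proof -
  obtain a w where \<omega>: "\<omega> = (a, w)" "a \<in> carrier G" "w \<in> chambers" using assms by auto
  then have W: "w \<in> weyl V" by (simp add: chambers_def)
  show ?thesis
  proof (cases "\<exists>x\<in>T. w (simple x) = simple v")
    case True
    then obtain x where x: "x \<in> T" "w (simple x) = simple v" by blast
    then have "cls [(x, b)] \<in> carrier G" using T by (intro cls_closed) auto
    then show ?thesis using step_fix[OF W x] \<omega> by simp
  next
    case False
    then show ?thesis using step_move[of w v b a] chamber_move[of w v] \<omega> assms by auto
  qed
qed

lemma step_inverse:
  assumes "v \<in> V" "\<omega> \<in> states"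
  shows "step (v, \<not> b) (step (v, b) \<omega>) = \<omega>"
proof -
  obtain a w where \<omega>: "\<omega> = (a, w)" "a \<in> carrier G" "w \<in> chambers" using assms by auto
  then have W: "w \<in> weyl V" by (simp add: chambers_def)
  show ?thesis
  proof (cases "\<exists>x\<in>T. w (simple x) = simple v")
    case True
    then obtain x where x: "x \<in> T" "w (simple x) = simple v" by blast
    then show ?thesis using step_fix[OF W x] \<omega> T mult_cls_cancel[of x a b] by auto
  next
    case False
    \<comment> \<open>The inverse letter must move the chamber back: if it fixed the new chamber,
      \<open>w\<close> would send \<open>simple x\<close> to the negative of
      \<open>simple v\<close>.\<close>
    have "(refl v \<circ> w) (simple x) \<noteq> simple v" if x: "x \<in> T" for x
    proof
      assume "(refl v \<circ> w) (simple x) = simple v"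
      then have "w (simple x) = refl v (simple v)" using assms by (metis comp_apply refl_refl)
      then have "w (simple x) v = -1" using assms by (simp add: refl_simple) (simp add: simple_def)
      then show False using \<omega> x by (auto simp: chambers_def nonneg_def dest!: bspec spec[of _ v])
    qed
    then show ?thesis using False step_move[of w v] step_move[of "refl v \<circ> w" v] \<omega> assms
      by (auto simp: o_assoc refl_comp)
  qed
qed

section \<open>The braid relations on chambers\<close>

lemma fold_step_move:
  assumes "\<And>j x. j < n \<Longrightarrow> x \<in> T \<Longrightarrow> alt j s t (w (simple x)) \<noteq> simple (if even j then s else t)"
  shows "fold step (alternating_word n s t) (a, w) = (a, alt n s t \<circ> w)"
  using assms
proof (induction n)
  case (Suc n)
  have "step (if even n then s else t, True) (a, alt n s t \<circ> w) = (a, refl (if even n then s else t) \<circ> (alt n s t \<circ> w))"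
    using Suc.prems[of n] by (intro step_move) simp
  moreover have "fold step (alternating_word n s t) (a, w) = (a, alt n s t \<circ> w)"
    using Suc by auto
  ultimately show ?case
    by (simp add: alternating_word_Suc_end alt_Suc_end comp_def del: alt.simps alternating_word.simps)
qed simp

lemma fold_step_fix:
  assumes "w \<in> weyl V" "x \<in> T" "y \<in> T" "w (simple x) = simple s" "w (simple y) = simple t" "a \<in> carrier G"
  shows "fold step (alternating_word n s t) (a, w) = (a \<otimes>\<^bsub>G\<^esub> cls (alternating_word n x y), w)"
  using assms
proof (induction n arbitrary: s t x y a)
  case (Suc n)
  have V: "[(x, True)] \<in> words V" "alternating_word n y x \<in> words V"
    using Suc.prems T by (auto intro!: alternating_words)
  then show ?case
    using Suc.IH[of y x t s "a \<otimes>\<^bsub>G\<^esub> cls [(x, True)]"] Suc.prems cls_closed[OF V(1)] cls_closed[OF V(2)]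
    by (simp add: step_fix[of w x] G.m_assoc cls_mult)
qed (simp add: cls_Nil)

lemma label_edge: "{s, t} \<in> edges \<Gamma> \<Longrightarrow> coxeter_label \<Gamma> \<mu> s t = \<mu> {s, t}"
  using edge_distinct[of s t] by (auto simp: coxeter_label_def)

lemma edge_label: "s \<noteq> t \<Longrightarrow> coxeter_label \<Gamma> \<mu> s t \<noteq> 0 \<Longrightarrow> {s, t} \<in> edges \<Gamma>"
  by (auto simp: coxeter_label_def split: if_splits)

text \<open>Reflections in \<open>s\<close> and \<open>t\<close> preserve this condition, so only
  those x in \<open>T\<close> whose root lies in the plane can become labels while a braid word is
  read. The braid relation is checked according to whether there are none, exactly one, or at least
  two of them.\<close>

definition in_plane :: "'v \<Rightarrow> 'v \<Rightarrow> ('v \<Rightarrow> real) \<Rightarrow> bool" where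
  "in_plane s t f \<longleftrightarrow> (\<forall>u. u \<noteq> s \<longrightarrow> u \<noteq> t \<longrightarrow> f u = 0)"

lemma in_plane_alt: "in_plane s t (alt n s t f) \<longleftrightarrow> in_plane s t f"
  by (auto simp: in_plane_def alt_outside)

lemma in_plane_commute: "in_plane s t f \<longleftrightarrow> in_plane t s f"
  by (auto simp: in_plane_def)

lemma in_plane_if_alt_simple: "alt n s t f = simple (if b then s else t) \<Longrightarrow> in_plane s t f"
  by (subst in_plane_alt[symmetric, of _ _ _ n]) (simp add: in_plane_def simple_def)

text \<open>Two labels in the plane of \<open>s\<close> and \<open>t\<close>: both braid words fix the chamber.\<close>

lemma braid_two:
  assumes e: "{s, t} \<in> edges \<Gamma>" and w: "w \<in> chambers" and a: "a \<in> carrier G"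
    and xy: "x \<in> T" "y \<in> T" "x \<noteq> y" "in_plane s t (w (simple x))" "in_plane s t (w (simple y))"
  shows "fold step (alternating_word (\<mu> {s, t}) s t) (a, w) = fold step (alternating_word (\<mu> {s, t}) t s) (a, w)"
proof -
  have st: "s \<in> V" "t \<in> V" "s \<noteq> t" using edge_distinct[OF e] by auto
  have W: "w \<in> weyl V" using w by (simp add: chambers_def)
  have V: "x \<in> V" "y \<in> V" using xy T by auto
  have nn: "nonneg (w (simple x))" "nonneg (w (simple y))" using w xy by (auto simp: chambers_def)
  have "simple s = w (simple x) \<or> simple s = w (simple y)"
    using xy by (intro simple_in_plane[OF W V(1) nn(1) _ V(2) nn(2) _ xy(3) st]) (auto simp: in_plane_def)
  moreover have "simple t = w (simple x) \<or> simple t = w (simple y)"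
    using xy st by (intro simple_in_plane[OF W V(1) nn(1) _ V(2) nn(2) _ xy(3), of t s]) (auto simp: in_plane_def)
  ultimately obtain x' y' where x': "x' \<in> T" "y' \<in> T" "x' \<noteq> y'" "w (simple x') = simple s" "w (simple y') = simple t"
    using xy st by (metis simple_inject)
  have V': "x' \<in> V" "y' \<in> V" using x' T by auto
  \<comment> \<open>Since \<open>w\<close> preserves the form, x' and y' carry the same label as
    \<open>s\<close> and \<open>t\<close>, and the braid relation of x' and y' equates the two
    recorded words.\<close>
  have "form (simple x') (simple y') = form (simple s) (simple t)"
    using weyl_form[OF W, of "simple x'" "simple y'"] x' by simp
  then have "coef x' y' = coef s t" using V' st by (simp add: form_simple pairing_simple)
  then have m: "coxeter_label \<Gamma> \<mu> x' y' = \<mu> {s, t}" using label_edge[OF e] by (simp add: coef_eq_iff)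
  then have e': "{x', y'} \<in> edges \<Gamma>" using edge_label[OF x'(3)] label_ge_2[OF e] by simp
  then have "cls (alternating_word (\<mu> {s, t}) x' y') = cls (alternating_word (\<mu> {s, t}) y' x')"
    using cls_braid[OF e'] label_edge[OF e'] m by simp
  then show ?thesis
    using fold_step_fix[OF W x'(1,2,4,5) a] fold_step_fix[OF W x'(2,1,5,4) a] by simp
qed

text \<open>A single label \<open>x\<close> in the plane: the orbit is a path of \<open>\<mu> {s, t}\<close> chambers, and only at its
  two ends is a chamber fixed by one of \<open>s\<close> and \<open>t\<close>, with label \<open>x\<close>. The path is parametrised from
  the end fixed by \<open>p\<close>.\<close>

lemma path_interior:
  assumes e: "{q, p} \<in> edges \<Gamma>" and v: "v \<in> weyl V" and x: "x \<in> T" "v (simple x) = simple p"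
    and only: "\<And>y. y \<in> T \<Longrightarrow> in_plane q p (v (simple y)) \<Longrightarrow> y = x" and j: "j < \<mu> {q, p}"
  shows "fold step (alternating_word j q p) (a, v) = (a, alt j q p \<circ> v)"
proof (rule fold_step_move)
  fix i y assume i: "i < j" and y: "y \<in> T"
  define k where "k = \<mu> {q, p}"
  have st: "q \<in> V" "p \<in> V" "q \<noteq> p" using edge_distinct[OF e] by auto
  have k: "coxeter_label \<Gamma> \<mu> q p = k" "k \<noteq> 0" using label_edge[OF e] label_ge_2[OF e] by (auto simp: k_def)
  show "alt i q p (v (simple y)) \<noteq> simple (if even i then q else p)"
  proof
    assume c: "alt i q p (v (simple y)) = simple (if even i then q else p)"
    then have "in_plane q p (v (simple y))" by (rule in_plane_if_alt_simple)
    then have "y = x" using only[OF y] by blast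
    \<comment> \<open>The term g(i + 1) is the coordinate of the image at the vertex not being
      tested. It is positive because 0 < i + 1 < k, whereas the tested simple root has coordinate 0
      there.\<close>
    define g where "g = dihedral_seq (pi / k) 0 1"
    have "alt i q p (simple p) = (if even i then lincomb (g i) (simple q) (g (i + 1)) (simple p)
        else lincomb (g (i + 1)) (simple q) (g i) (simple p))"
      using alt_plane_seq[of q p i 0 1] st k by (simp add: g_def)
    then have "alt i q p (simple p) (if even i then p else q) = g (i + 1)"
      using st by (simp add: simple_def)
    moreover have "alt i q p (simple p) = simple (if even i then q else p)"
      using c x(2) \<open>y = x\<close> by simp
    then have "alt i q p (simple p) (if even i then p else q) = 0"
      using st by (simp add: simple_def)
    ultimately have "g (i + 1) = 0" by simp
    moreover have "0 < g (i + 1)"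
    proof -
      have ik: "i + 1 < k" using i j k_def by simp
      have "real (i + 1) * (pi / k) < real k * (pi / k)"
        using ik by (intro mult_strict_right_mono) auto
      then have "0 < sin (real (i + 1) * (pi / k))" using ik by (intro sin_gt_zero) auto
      moreover have "0 < sin (pi / k)" using sin_pos_m[OF st(3)] k by simp
      ultimately show ?thesis by (simp add: g_def dihedral_seq_def)
    qed
    ultimately show False by simp
  qed
qed

text \<open>With k = n + 1 the two coordinates are sin(pi - pi/k) / sin(pi/k) = 1 and sin(pi) /
  sin(pi/k) = 0. Hence the far end of the path is again fixed by a generator, with the same
  label.\<close>

lemma path_end:
  assumes e: "{q, p} \<in> edges \<Gamma>" and k: "\<mu> {q, p} = Suc n"
  shows "alt n q p (simple p) = simple (if even n then q else p)"
proof -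
  have st: "q \<in> V" "p \<in> V" "q \<noteq> p" using edge_distinct[OF e] by auto
  have l: "coxeter_label \<Gamma> \<mu> q p = Suc n" using label_edge[OF e] k by simp
  define g where "g = dihedral_seq (pi / Suc n) 0 1"
  have s: "0 < sin (pi / Suc n)" using sin_pos_m[OF st(3)] l by simp
  have "g (Suc n) = 0" using dihedral_seq_period(1)[of "Suc n" 0 1] s by (simp add: g_def)
  moreover have "real n * (pi / Suc n) = pi - pi / Suc n" by (simp add: field_simps)
  then have "g n = 1" using s by (simp add: g_def dihedral_seq_def)
  ultimately show ?thesis
    using alt_plane_seq[of q p n 0 1] st l by (auto simp: g_def fun_eq_iff)
qed

text \<open>If every letter of the braid word moved the chamber, the result would still be a
  chamber. But the longest element sends the positive root in the plane to a negative one.\<close>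

lemma path_hits_end:
  assumes e: "{s, t} \<in> edges \<Gamma>" and w: "w \<in> chambers" and x: "x \<in> T" "in_plane s t (w (simple x))"
    and only: "\<And>y. y \<in> T \<Longrightarrow> in_plane s t (w (simple y)) \<Longrightarrow> y = x"
  shows "\<exists>d<\<mu> {s, t}. alt d s t (w (simple x)) = simple (if even d then s else t)"
proof (rule ccontr)
  assume c: "\<not> ?thesis"
  define k where "k = \<mu> {s, t}"
  have st: "s \<in> V" "t \<in> V" "s \<noteq> t" using edge_distinct[OF e] by auto
  have k: "coxeter_label \<Gamma> \<mu> s t = k" "k \<noteq> 0" using label_edge[OF e] label_ge_2[OF e] by (auto simp: k_def)
  have W: "w \<in> weyl V" "nonneg (w (simple x))" using w x by (auto simp: chambers_def)
  have "fold step (alternating_word k s t) (\<one>\<^bsub>G\<^esub>, w) = (\<one>\<^bsub>G\<^esub>, alt k s t \<circ> w)"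
  proof (rule fold_step_move, rule notI)
    fix j y assume j: "j < k" "y \<in> T" "alt j s t (w (simple y)) = simple (if even j then s else t)"
    from j(3) have "in_plane s t (w (simple y))" by (rule in_plane_if_alt_simple)
    then have "y = x" using only j by blast
    then show False using c j by (auto simp: k_def)
  qed
  moreover have "alternating_word k s t \<in> words V" using st by (intro alternating_words)
  then have "fold step (alternating_word k s t) (\<one>\<^bsub>G\<^esub>, w) \<in> states"
    using fold_closed[where step = step, OF step_closed] w by simp
  ultimately have "nonneg (alt k s t (w (simple x)))" using x by (auto simp: chambers_def)
  moreover define a b where "a = w (simple x) s" and "b = w (simple x) t"
  have f: "w (simple x) = lincomb a (simple s) b (simple t)"
    unfolding a_def b_def using x st by (intro plane_decomp) (auto simp: in_plane_def)
  have "alt k s t (lincomb a (simple s) b (simple t)) = (if even k then lincomb (-a) (simple s) (-b) (simple t)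
      else lincomb (-b) (simple s) (-a) (simple t))"
    using alt_plane_full[of s t a b] st k by simp
  ultimately have "nonneg (if even k then lincomb (-a) (simple s) (-b) (simple t)
      else lincomb (-b) (simple s) (-a) (simple t))" by (simp only: f)
  then have "0 \<le> (if even k then lincomb (-a) (simple s) (-b) (simple t) else lincomb (-b) (simple s) (-a) (simple t)) u" for u
    by (simp add: nonneg_def)
  from this[of s] this[of t] have "a \<le> 0" "b \<le> 0"
    using st by (auto simp: simple_def split: if_splits)
  moreover have "0 \<le> a" "0 \<le> b" using W by (auto simp: a_def b_def nonneg_def)
  ultimately have "w (simple x) = (\<lambda>u. 0)" using f by simp
  then show False using weyl_root_nonzero[OF W(1)] by blast
qed

text \<open>The chamber \<open>w\<close> lies d moves from the end \<open>v\<close> and n from the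
  end \<open>v2\<close>, and the label is d + 1 + n. One braid word makes d moves to
  \<open>v\<close>, records x there and returns n moves; the other makes n moves to
  \<open>v2\<close>, records x and returns d moves. Both stop n moves away from
  \<open>v\<close>.\<close>

lemma braid_one:
  assumes e: "{s, t} \<in> edges \<Gamma>" and w: "w \<in> chambers" and a: "a \<in> carrier G"
    and x: "x \<in> T" "in_plane s t (w (simple x))"
    and only: "\<And>y. y \<in> T \<Longrightarrow> in_plane s t (w (simple y)) \<Longrightarrow> y = x"
  shows "fold step (alternating_word (\<mu> {s, t}) s t) (a, w) = fold step (alternating_word (\<mu> {s, t}) t s) (a, w)"
proof -
  have st: "s \<in> V" "t \<in> V" "s \<noteq> t" using edge_distinct[OF e] by auto
  have W: "w \<in> weyl V" using w by (simp add: chambers_def)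
  define d where "d = (LEAST d. alt d s t (w (simple x)) = simple (if even d then s else t))"
  obtain d' where d': "d' < \<mu> {s, t}" "alt d' s t (w (simple x)) = simple (if even d' then s else t)"
    using path_hits_end[OF e w x only] by blast
  have d: "alt d s t (w (simple x)) = simple (if even d then s else t)"
    unfolding d_def by (rule LeastI[where P = "\<lambda>d. alt d s t (w (simple x)) = simple (if even d then s else t)", OF d'(2)])
  have "d \<le> d'" unfolding d_def by (rule Least_le) (rule d'(2))
  then obtain n where n: "\<mu> {s, t} = Suc (d + n)" using d' by (metis add_Suc_right less_imp_Suc_add order_le_less_trans)
  have bwd: "fold step (alternating_word d s t) (a, w) = (a, alt d s t \<circ> w)"
  proof (rule fold_step_move, rule notI)
    fix j y assume j: "j < d" "y \<in> T" "alt j s t (w (simple y)) = simple (if even j then s else t)"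
    from j(3) have "in_plane s t (w (simple y))" by (rule in_plane_if_alt_simple)
    then have "y = x" using only j by blast
    then show False using not_less_Least[of j "\<lambda>d. alt d s t (w (simple x)) = simple (if even d then s else t)"] j
      by (simp add: d_def)
  qed
  \<comment> \<open>\<open>p\<close> is the letter that fixes the end reached after d moves, and
    \<open>q\<close> the letter that leads away from it.\<close>
  define p q where "p = (if even d then s else t)" and "q = (if even d then t else s)"
  have pq: "{q, p} = {s, t}" "q \<in> V" "p \<in> V" using st by (auto simp: p_def q_def)
  have plane: "in_plane q p f \<longleftrightarrow> in_plane s t f" for f
    using in_plane_commute by (auto simp: p_def q_def)
  define v where "v = alt d s t \<circ> w"
  have v: "v \<in> weyl V" "v (simple x) = simple p" using alt_comp_weyl st W d by (auto simp: v_def p_def)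
  have w_v: "w = alt d q p \<circ> v"
    unfolding v_def p_def q_def using alt_inverse[OF st(1,2)] by (auto simp: fun_eq_iff)
  have only_v: "y = x" if "y \<in> T" "in_plane q p (v (simple y))" for y
    using only that by (simp add: plane v_def in_plane_alt)
  have e': "{q, p} \<in> edges \<Gamma>" and k: "\<mu> {q, p} = Suc (d + n)" using e pq n by auto
  note int_v = path_interior[OF e' v(1) x(1) v(2) only_v]
  let ?ax = "a \<otimes>\<^bsub>G\<^esub> cls [(x, True)]"
  have "alternating_word (\<mu> {s, t}) s t = alternating_word d s t @ (p, True) # alternating_word n q p"
    using alternating_word_add[of d "Suc n" s t] n by (simp add: p_def q_def)
  then have 1: "fold step (alternating_word (\<mu> {s, t}) s t) (a, w) = (?ax, alt n q p \<circ> v)"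
    using bwd step_fix[OF v(1) x(1) v(2)] int_v[of n ?ax] k by (simp flip: v_def)
  define v2 where "v2 = alt (d + n) q p \<circ> v"
  define p2 q2 where "p2 = (if even (d + n) then q else p)" and "q2 = (if even (d + n) then p else q)"
  have pq2: "{q2, p2} = {s, t}" using pq by (auto simp: p2_def q2_def)
  have plane2: "in_plane q2 p2 f \<longleftrightarrow> in_plane s t f" for f
    using plane in_plane_commute by (auto simp: p2_def q2_def)
  have v2: "v2 \<in> weyl V" "v2 (simple x) = simple p2"
    using alt_comp_weyl pq v path_end[OF e' k] by (auto simp: v2_def p2_def)
  have only_v2: "y = x" if "y \<in> T" "in_plane q2 p2 (v2 (simple y))" for y
    using only_v[OF that(1)] that(2) by (simp add: plane2 v2_def plane[symmetric] in_plane_alt)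
  have e2: "{q2, p2} \<in> edges \<Gamma>" and k2: "\<mu> {q2, p2} = Suc (d + n)" using e pq2 n by auto
  note int_v2 = path_interior[OF e2 v2(1) x(1) v2(2) only_v2]
  have "alternating_word (d + n) q p = alternating_word d q p @ alternating_word n t s"
    using alternating_word_add[of d n q p] by (simp add: p_def q_def)
  then have fwd: "fold step (alternating_word n t s) (a, w) = (a, v2)"
    using int_v[of "d + n" a] int_v[of d a] k by (simp flip: w_v v2_def)
  have "alternating_word (\<mu> {s, t}) t s = alternating_word n t s @ (p2, True) # alternating_word d q2 p2"
    using alternating_word_add[of n "Suc d" t s] n by (auto simp: p_def q_def p2_def q2_def add.commute)
  then have 2: "fold step (alternating_word (\<mu> {s, t}) t s) (a, w) = (?ax, alt d q2 p2 \<circ> v2)"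
    using fwd step_fix[OF v2(1) x(1) v2(2)] int_v2[of d ?ax] k2 by simp
  have "alt d q2 p2 \<circ> v2 = alt n q p \<circ> v"
  proof (cases "even n")
    case True
    then have "v2 = alt d q p \<circ> (alt n q p \<circ> v)"
      using alt_add[of n d q p] by (simp add: v2_def add.commute comp_assoc)
    then show ?thesis
      using alt_inverse[OF pq(2,3), of d] True by (cases "even d") (simp_all add: p2_def q2_def comp_def)
  next
    case False
    then have "v2 = alt d p q \<circ> (alt n q p \<circ> v)"
      using alt_add[of n d q p] by (simp add: v2_def add.commute comp_assoc)
    then show ?thesis
      using alt_inverse[OF pq(3,2), of d] False by (cases "even d") (simp_all add: p2_def q2_def comp_def)
  qed
  then show ?thesis using 1 2 by simp
qed

lemma step_braid:
  assumes e: "{s, t} \<in> edges \<Gamma>" and \<omega>: "\<omega> \<in> states"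
  shows "fold step (alternating_word (\<mu> {s, t}) s t) \<omega> = fold step (alternating_word (\<mu> {s, t}) t s) \<omega>"
proof -
  obtain a w where aw: "\<omega> = (a, w)" "a \<in> carrier G" "w \<in> chambers" using \<omega> by auto
  have st: "s \<in> V" "t \<in> V" "s \<noteq> t" using edge_distinct[OF e] by auto
  consider "\<And>x. x \<in> T \<Longrightarrow> \<not> in_plane s t (w (simple x))"
    | x where "x \<in> T" "in_plane s t (w (simple x))" "\<And>y. y \<in> T \<Longrightarrow> in_plane s t (w (simple y)) \<Longrightarrow> y = x"
    | x y where "x \<in> T" "y \<in> T" "x \<noteq> y" "in_plane s t (w (simple x))" "in_plane s t (w (simple y))"
    by blast
  then show ?thesis
  proof cases
    case 1
    have "fold step (alternating_word n q p) (a, w) = (a, alt n q p \<circ> w)" if "{q, p} = {s, t}" for n q p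
    proof (rule fold_step_move, rule notI)
      fix j y assume j: "y \<in> T" "alt j q p (w (simple y)) = simple (if even j then q else p)"
      from j(2) have "in_plane q p (w (simple y))" by (rule in_plane_if_alt_simple)
      then show False using 1[OF j(1)] that in_plane_commute by (metis doubleton_eq_iff)
    qed
    moreover have "alt (\<mu> {s, t}) s t = alt (\<mu> {s, t}) t s"
      using alt_braid[OF st] label_edge[OF e] label_ge_2[OF e] by simp
    ultimately show ?thesis using aw by (simp add: insert_commute)
  next
    case 2
    then show ?thesis using braid_one[OF e aw(3,2)] aw by blast
  next
    case 3
    then show ?thesis using braid_two[OF e aw(3,2)] aw by blast
  qed
qed

lemma step_relation:
  assumes "(u, v) \<in> artin_relations \<Gamma> \<mu>" "\<omega> \<in> states"
  shows "fold step u \<omega> = fold step v \<omega>"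
  using assms step_braid by (auto simp: artin_relations_def)

lemma fold_step_cls:
  assumes "v \<in> words V" "cls u = cls v" "\<omega> \<in> states"
  shows "fold step u \<omega> = fold step v \<omega>"
  using fold_word_eq[of V states step, OF step_closed step_inverse step_relation] assms
  by (simp add: word_class_eq_iff)

section \<open>Elements of the parabolic subgroup that commute with an outside vertex\<close>

lemma id_chamber: "id \<in> chambers"
  using weyl_id by (simp add: chambers_def nonneg_def simple_def)

lemma fold_step_id:
  "w \<in> words T \<Longrightarrow> a \<in> carrier G \<Longrightarrow> fold step w (a, id) = (a \<otimes>\<^bsub>G\<^esub> cls w, id)"
proof (induction w arbitrary: a)
  case (Cons l w)
  obtain v b where l: "l = (v, b)" by (cases l)
  have V: "[l] \<in> words V" "w \<in> words V" "v \<in> T" using Cons.prems T words_mono[OF T] l by auto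
  then have "step l (a, id) = (a \<otimes>\<^bsub>G\<^esub> cls [l], id)"
    unfolding l by (intro step_fix weyl_id) auto
  moreover have "fold step w (a \<otimes>\<^bsub>G\<^esub> cls [l], id) = (a \<otimes>\<^bsub>G\<^esub> cls [l] \<otimes>\<^bsub>G\<^esub> cls w, id)"
    using Cons.prems V by (intro Cons.IH) (auto simp: cls_closed)
  moreover have "a \<otimes>\<^bsub>G\<^esub> cls [l] \<otimes>\<^bsub>G\<^esub> cls w = a \<otimes>\<^bsub>G\<^esub> cls (l # w)"
    using Cons.prems V by (simp add: cls_closed G.m_assoc cls_mult)
  ultimately show ?case by (simp only: fold_simps)
qed (simp add: cls_Nil)

text \<open>A letter r in \<open>T\<close> changes at most the coordinate at r \<noteq> s, so the
  s-coordinates stay equal to \<open>coef s x\<close>. When r fixes the chamber with label x, the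
  image of \<open>simple x\<close> is \<open>simple r\<close>, whose s-coordinate is 0; hence x lies
  in \<open>U\<close>.\<close>

lemma fold_step_refl:
  assumes s: "s \<in> V - T"
  defines "U \<equiv> {x \<in> T. coef s x = 0}"
  assumes "w \<in> words T" "a \<in> parabolic U" "v \<in> chambers" "\<And>x. x \<in> T \<Longrightarrow> v (simple x) s = coef s x"
  shows "fst (fold step w (a, v)) \<in> parabolic U"
  using assms(3-)
proof (induction w arbitrary: a v)
  case (Cons l w)
  obtain r b where l: "l = (r, b)" by (cases l)
  have r: "r \<in> T" "r \<noteq> s" "r \<in> V" "w \<in> words T" using Cons.prems l s T by auto
  have W: "v \<in> weyl V" using Cons.prems by (simp add: chambers_def)
  show ?case
  proof (cases "\<exists>x\<in>T. v (simple x) = simple r")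
    case True
    then obtain x where x: "x \<in> T" "v (simple x) = simple r" by blast
    then have "coef s x = 0" using Cons.prems(4)[of x] r by (simp add: simple_def)
    then have "cls [(x, b)] \<in> parabolic U" using x unfolding parabolic_def U_def by (intro imageI) simp
    moreover have "U \<subseteq> V" using T by (auto simp: U_def)
    ultimately have "a \<otimes>\<^bsub>G\<^esub> cls [(x, b)] \<in> parabolic U" using Cons.prems by (intro parabolic_mult)
    then show ?thesis using Cons.IH[OF r(4)] Cons.prems step_fix[OF W x] l by simp
  next
    case False
    then have "refl r \<circ> v \<in> chambers" using chamber_move[of v r] Cons.prems r by blast
    moreover have "(refl r \<circ> v) (simple x) s = coef s x" if "x \<in> T" for x
      using Cons.prems(4)[OF that] r refl_other[of s r] by simp
    ultimately show ?thesis using Cons.IH[OF r(4), of a "refl r \<circ> v"] Cons.prems False step_move[of v r b a] l by (auto simp: comp_def)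
  qed
qed simp

theorem commuting_parabolic:
  assumes z: "z \<in> parabolic T" and s: "s \<in> V - T" and comm: "z \<otimes>\<^bsub>G\<^esub> cls [(s, True)] = cls [(s, True)] \<otimes>\<^bsub>G\<^esub> z"
  shows "z \<in> parabolic {x \<in> T. coef s x = 0}"
proof -
  obtain w where w: "w \<in> words T" "z = cls w" using z by (auto simp: parabolic_def)
  have V: "w \<in> words V" "[(s, True)] \<in> words V" "[(s, False)] \<in> words V"
    using words_mono[OF T] w s by auto
  let ?u = "[(s, True)] @ w @ [(s, False)]"
  have "cls ?u = cls [(s, True)] \<otimes>\<^bsub>G\<^esub> z \<otimes>\<^bsub>G\<^esub> cls [(s, False)]"
    using V w by (simp add: cls_mult)
  also have "\<dots> = z" unfolding comm[symmetric] using mult_cls_cancel[of s z True] s w V cls_closed by simp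
  finally have u: "cls ?u = cls w" using w by simp
  let ?\<omega> = "fold step w (\<one>\<^bsub>G\<^esub>, refl s)"
  have nfix: "id (simple x) \<noteq> simple s" if "x \<in> T" for x using that s by auto
  have move: "step (s, b) (a, id) = (a, refl s)" for a b using step_move[of id s b a] nfix by simp
  have "fold step ?u (\<one>\<^bsub>G\<^esub>, id) = fold step w (\<one>\<^bsub>G\<^esub>, id)"
    using u V id_chamber by (intro fold_step_cls) auto
  then have "step (s, False) ?\<omega> = (z, id)"
    using fold_step_id[OF w(1)] move[of True] w V cls_closed by simp
  moreover have rc: "refl s \<in> chambers"
    using chamber_move[OF id_chamber, of s] nfix s by simp
  then have "?\<omega> \<in> states"
    using fold_closed[where step = step, OF step_closed] V by simp
  \<comment> \<open>Undoing the final letter: reading \<open>w\<close> from the chamber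
    \<open>refl s\<close> ends at the first component z, and \<open>fold_step_refl\<close> describes
    that component.\<close>
  ultimately have \<omega>: "step (s, True) (z, id) = ?\<omega>"
    using step_inverse[of s ?\<omega> False] s by simp
  have "(refl s) (simple x) s = coef s x" if "x \<in> T" for x
    using that T s unfolding refl_def by (simp add: pairing_simple subsetD) (auto simp: simple_def)
  then have "fst ?\<omega> \<in> parabolic {x \<in> T. coef s x = 0}"
    using w rc s by (intro fold_step_refl) (auto simp: parabolic_def simp flip: cls_Nil)
  then show ?thesis using \<omega> move by (metis fst_conv)
qed

end

section \<open>Triviality of the center\<close>

context artin
begin

theorem center_trivial:
  assumes "artin_irreducible \<Gamma> \<mu>" "\<not> is_clique \<Gamma>"
  shows "center G = {\<one>\<^bsub>G\<^esub>}"
proof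
  show "{\<one>\<^bsub>G\<^esub>} \<subseteq> center G" by (simp add: center_def)
  show "center G \<subseteq> {\<one>\<^bsub>G\<^esub>}"
  proof
    fix z assume z: "z \<in> center G"
    obtain s t where st: "s \<in> V" "t \<in> V" "s \<noteq> t" "{s, t} \<notin> edges \<Gamma>"
      using assms(2) by (auto simp: is_clique_def)
    then interpret N: artin_nonedge \<Gamma> \<mu> s t by unfold_locales
    \<comment> \<open>Strict inclusion leaves a vertex outside \<open>U\<close>, from which a path
      in the Coxeter graph can cross into \<open>U\<close>.\<close>
    define P where "P U \<longleftrightarrow> U \<subset> V \<and> z \<in> parabolic U" for U
    have "P (V - {s}) \<or> P (V - {t})"
      using N.central_in_factor[OF z] st by (auto simp: P_def)
    then obtain U where U: "P U" by blast
    define T where "T = arg_min card P"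
    have T: "P T" "\<And>U. P U \<Longrightarrow> card T \<le> card U"
      unfolding T_def using arg_min_natI[of P, OF U] arg_min_nat_le[of P] by auto
    then have TV: "T \<subset> V" "z \<in> parabolic T" "finite T" using finite_S finite_subset by (auto simp: P_def)
    have "T = {}"
    proof (rule ccontr)
      assume "T \<noteq> {}"
      then obtain x y where "x \<in> T" "y \<in> V" "y \<notin> T" using TV by blast
      then have "(x, y) \<in> {(u, v). {u, v} \<in> edges (coxeter_graph \<Gamma> \<mu>)}\<^sup>*"
        using assms(1) TV by (auto simp: artin_irreducible_def graph_connected_def coxeter_graph_def)
      then have "\<exists>u v. u \<in> T \<and> v \<notin> T \<and> {u, v} \<in> edges (coxeter_graph \<Gamma> \<mu>)"
        using \<open>x \<in> T\<close> \<open>y \<notin> T\<close> by (induction rule: rtrancl_induct) auto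
      then obtain u v where uv: "u \<in> T" "v \<notin> T" "{u, v} \<in> edges (coxeter_graph \<Gamma> \<mu>)" by blast
      then have v: "v \<in> V" "{v, u} \<notin> edges \<Gamma> \<or> 3 \<le> \<mu> {v, u}"
        by (auto simp: coxeter_graph_def doubleton_eq_iff insert_commute)
      interpret R: artin_retraction \<Gamma> \<mu> T using TV by unfold_locales auto
      \<comment> \<open>A label at least 3, or the label 0 for a non-edge, puts the angle in [0,
        pi/2). Thus u is dropped from \<open>T\<close>, against the choice of a smallest
        \<open>T\<close>.\<close>
      have "0 < coef v u"
      proof -
        let ?k = "coxeter_label \<Gamma> \<mu> v u"
        have "?k = 0 \<or> 3 \<le> ?k" using v uv by (auto simp: coxeter_label_def)
        then have "0 < cos (pi / ?k)" by (elim disjE) (auto intro!: cos_gt_zero simp: field_simps)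
        then show ?thesis by (simp add: coef_def)
      qed
      then have "u \<notin> {x \<in> T. coef v x = 0}" by simp
      then have "{x \<in> T. coef v x = 0} \<subset> T" using uv by blast
      then have "card {x \<in> T. coef v x = 0} < card T" using TV by (intro psubset_card_mono)
      moreover have "[(v, True)] \<in> words V" using v by simp
      then have "z \<in> parabolic {x \<in> T. coef v x = 0}"
        using z TV v uv cls_closed by (intro R.commuting_parabolic) (auto simp: center_def)
      then have "P {x \<in> T. coef v x = 0}" using TV by (auto simp: P_def)
      ultimately show False using T(2) by (meson not_less)
    qed
    then have "z \<in> cls ` words {}" using TV by (simp add: parabolic_def)
    then show "z \<in> {\<one>\<^bsub>G\<^esub>}" by (auto simp: words_def cls_Nil)
  qed
qed

end

theorem corollary1p4:
  fixes \<Gamma> :: "'v sgraph" and \<mu> :: "'v set \<Rightarrow> nat"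
  defines "A \<equiv> artin_group \<Gamma> \<mu>"
    and "A\<^sub>0 \<equiv> artin_subgroup \<Gamma> \<mu> (maximal_clique_factor \<Gamma>)"
  assumes "finite_simple_graph \<Gamma>"
    and "\<And>e. e \<in> edges \<Gamma> \<Longrightarrow> 2 \<le> \<mu> e"
    and "artin_irreducible \<Gamma> \<mu>"
    and "\<not> is_clique \<Gamma>"
  shows "finite (center A) \<and>
    center A \<subseteq> center A\<^sub>0 \<and>
    (center A\<^sub>0 = {\<one>\<^bsub>A\<^sub>0\<^esub>} \<or> torsion_free (A\<^sub>0\<lparr>carrier := center A\<^sub>0\<rparr>) \<longrightarrow> center A = {\<one>\<^bsub>A\<^esub>})"
proof -
  interpret artin \<Gamma> \<mu> using assms by unfold_locales
  have A: "center A = {\<one>\<^bsub>A\<^esub>}" unfolding A_def using assms by (intro center_trivial)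
  interpret A0: group A\<^sub>0
    unfolding A\<^sub>0_def artin_subgroup_def by (rule G.group_subgroup_generated)
  \<comment> \<open>Once the center of \<open>A\<close> is known to be trivial, all the claims
    reduce to the two groups having the same identity, which is always central.\<close>
  have "\<one>\<^bsub>A\<^sub>0\<^esub> \<in> center A\<^sub>0" by (simp add: center_def)
  moreover have "\<one>\<^bsub>A\<^sub>0\<^esub> = \<one>\<^bsub>A\<^esub>"
    by (simp add: A\<^sub>0_def A_def artin_subgroup_def)
  ultimately show ?thesis using A by simp
qed

end
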